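(* Let $\mathcal F$ be a minimal family of finite connected relational structures of a finite type $\Delta$, and let $r\ge 1$. There exists a class $\mathcal K$ of lifts of type $\Delta'\supseteq\Delta$, all of whose new relations have arity at most $r$, such that the class of shadows of $\mathcal K$ is $\mathrm{Forb}_h(\mathcal F)$ and $\mathcal K$ contains a generic structure, if and only if every minimal cut of every $\mathbf F\in\mathcal F$ consists of at most $r$ vertices.
   Context: A minimal family is a finite family of finite structures that are all cores (every endomorphism is an automorphism) with no homomorphism between two distinct members. $\mathrm{Forb}_h(\mathcal F)$ is the class of countable structures of type $\Delta$ admitting no homomorphism from any member of $\mathcal F$. A lift of a structure $\mathbf A$ of type $\Delta$ is a structure of a larger type $\Delta'$ (extra relation symbols) whose reduct to $\Delta$ is $\mathbf A$; $\mathbf A$ is its shadow. The Gaifman graph of a structure has its vertices, with $x\neq y$ adjacent iff they occur in a common tuple of some relation; a minimal cut is an inclusion-minimal set of vertices whose removal disconnects the Gaifman graph. A structure is generic for a class if it belongs to it, is ultrahomogeneous (every isomorphism of finite induced substructures extends to an automorphism), and every member of the class embeds into it.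
   Formalization: The type Δ' is required to be finite, and "minimal cut" means a set separating some two vertices of the Gaifman graph no proper subset of which separates the same two vertices, rather than a set minimal among all disconnecting sets; the claim is false otherwise. *)

theory Defs
  imports Main
begin

text \<open>
  A type assigns a positive arity to each of finitely many relation symbols; symbols are coded as
  natural numbers, so \<^term>\<open>\<Delta> \<subseteq>\<^sub>m \<Delta>'\<close> says that the type \<open>\<Delta>'\<close> extends \<open>\<Delta>\<close>.
\<close>

type_synonym signature = "nat \<rightharpoonup> nat"

definition finite_type :: "signature \<Rightarrow> bool" where
  "finite_type \<Delta> \<longleftrightarrow> finite (dom \<Delta>) \<and> 0 \<notin> ran \<Delta>"

record 'v rstruct =
  verts :: "'v set"
  rel :: "nat \<Rightarrow> 'v list set"

text \<open>
  Symbols outside the type are interpreted by the empty relation, so that equality of structures of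
  the same type is equality of the vertex sets and of the relations.  The vertex set may be empty.
\<close>

definition structure_of :: "signature \<Rightarrow> 'v rstruct \<Rightarrow> bool" where
  "structure_of \<Delta> A \<longleftrightarrow>
     (\<forall>i xs. xs \<in> rel A i \<longrightarrow> \<Delta> i = Some (length xs) \<and> set xs \<subseteq> verts A)"

definition induced :: "'v rstruct \<Rightarrow> 'v set \<Rightarrow> 'v rstruct" where
  "induced A S = \<lparr>verts = verts A \<inter> S, rel = (\<lambda>i. {xs \<in> rel A i. set xs \<subseteq> S})\<rparr>"

definition shadow :: "signature \<Rightarrow> 'v rstruct \<Rightarrow> 'v rstruct" where
  "shadow \<Delta> A = \<lparr>verts = verts A, rel = (\<lambda>i. if i \<in> dom \<Delta> then rel A i else {})\<rparr>"

definition is_hom :: "'v rstruct \<Rightarrow> 'w rstruct \<Rightarrow> ('v \<Rightarrow> 'w) \<Rightarrow> bool" where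
  "is_hom A B f \<longleftrightarrow> f ` verts A \<subseteq> verts B \<and> (\<forall>i. \<forall>xs \<in> rel A i. map f xs \<in> rel B i)"

definition is_embedding :: "'v rstruct \<Rightarrow> 'w rstruct \<Rightarrow> ('v \<Rightarrow> 'w) \<Rightarrow> bool" where
  "is_embedding A B f \<longleftrightarrow> f ` verts A \<subseteq> verts B \<and> inj_on f (verts A) \<and>
     (\<forall>i xs. set xs \<subseteq> verts A \<longrightarrow> (xs \<in> rel A i \<longleftrightarrow> map f xs \<in> rel B i))"

definition is_iso :: "'v rstruct \<Rightarrow> 'w rstruct \<Rightarrow> ('v \<Rightarrow> 'w) \<Rightarrow> bool" where
  "is_iso A B f \<longleftrightarrow> is_embedding A B f \<and> f ` verts A = verts B"

definition is_core :: "'v rstruct \<Rightarrow> bool" where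
  "is_core A \<longleftrightarrow> (\<forall>f. is_hom A A f \<longrightarrow> is_iso A A f)"

definition minimal_family :: "signature \<Rightarrow> 'v rstruct set \<Rightarrow> bool" where
  "minimal_family \<Delta> \<F> \<longleftrightarrow> finite \<F> \<and>
     (\<forall>F\<in>\<F>. structure_of \<Delta> F \<and> finite (verts F) \<and> is_core F) \<and>
     (\<forall>F\<in>\<F>. \<forall>F'\<in>\<F>. F \<noteq> F' \<longrightarrow> \<not> (\<exists>f. is_hom F F' f))"

text \<open>
  Every countable structure is isomorphic to one whose vertices are natural numbers; classes of
  countable structures are therefore represented by sets of structures with vertices in \<^typ>\<open>nat\<close>.
\<close>

definition Forb_h :: "signature \<Rightarrow> 'v rstruct set \<Rightarrow> nat rstruct set" where
  "Forb_h \<Delta> \<F> = {A. structure_of \<Delta> A \<and> (\<forall>F\<in>\<F>. \<not> (\<exists>f. is_hom F A f))}"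

definition ultrahomogeneous :: "'v rstruct \<Rightarrow> bool" where
  "ultrahomogeneous U \<longleftrightarrow>
     (\<forall>S T f. finite S \<and> S \<subseteq> verts U \<and> T \<subseteq> verts U \<and> is_iso (induced U S) (induced U T) f \<longrightarrow>
        (\<exists>g. is_iso U U g \<and> (\<forall>x\<in>S. g x = f x)))"

definition generic_for :: "'v rstruct set \<Rightarrow> 'v rstruct \<Rightarrow> bool" where
  "generic_for \<K> U \<longleftrightarrow> U \<in> \<K> \<and> ultrahomogeneous U \<and> (\<forall>A\<in>\<K>. \<exists>f. is_embedding A U f)"

definition gaifman :: "'v rstruct \<Rightarrow> ('v \<times> 'v) set" where
  "gaifman A = {(x, y). x \<noteq> y \<and> (\<exists>i. \<exists>xs \<in> rel A i. x \<in> set xs \<and> y \<in> set xs)}"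

text \<open>
  Connected structures are nonempty: the empty structure maps into everything, so as a forbidden
  structure it would leave no structure at all.
\<close>

definition connected_structure :: "'v rstruct \<Rightarrow> bool" where
  "connected_structure A \<longleftrightarrow> verts A \<noteq> {} \<and>
     (\<forall>x\<in>verts A. \<forall>y\<in>verts A. (x, y) \<in> (gaifman A)\<^sup>*)"

definition separates :: "'v rstruct \<Rightarrow> 'v set \<Rightarrow> 'v \<Rightarrow> 'v \<Rightarrow> bool" where
  "separates A C x y \<longleftrightarrow> C \<subseteq> verts A \<and> x \<in> verts A - C \<and> y \<in> verts A - C \<and>
     (x, y) \<notin> (gaifman A \<inter> (verts A - C) \<times> (verts A - C))\<^sup>*"

text \<open>
  Minimality of a cut refers to the vertices being disconnected: no proper subset still disconnects
  the same two vertices.  (Requiring instead that no proper subset be a cut at all would be too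
  restrictive: in a 5-cycle with a pendant vertex attached to each of its vertices, single cycle
  vertices cut off the pendants, and the two-vertex cuts of the cycle would not count as minimal,
  although unary relations cannot record on which pairs their pieces sit.)
\<close>

definition minimal_cut :: "'v rstruct \<Rightarrow> 'v set \<Rightarrow> bool" where
  "minimal_cut A C \<longleftrightarrow> (\<exists>x y. separates A C x y \<and> (\<forall>C'. C' \<subset> C \<longrightarrow> \<not> separates A C' x y))"

end

theory Submission
  imports Defs "HOL-Library.FuncSet" "HOL-Library.Countable"
begin

text \<open>
  If all minimal cuts have at most \<open>r\<close> vertices, add for every \<^emph>\<open>piece\<close> of a forbidden structure
  (one side of a minimal cut together with the cut) a relation that holds for the images of the cut
  under homomorphisms of the piece.  Two structures whose lifts agree on their common part can be
  amalgamated freely: a homomorphism from a piece into the amalgam with its cut in one of the two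
  sides can be pushed into that side by replacing smaller pieces one at a time, so the amalgam
  creates neither new tuples in the lift nor a forbidden homomorphism.  A Fraisse-type chain of such
  amalgams yields the generic lift.

  Conversely, let \<open>C\<close> be a minimal cut of \<open>F\<close> with more than \<open>r\<close> vertices.  Blow up every vertex of
  \<open>C\<close> to \<open>N\<close> copies and attach to every transversal one of the two sides of the cut, according to a
  two-colouring.  This never admits a homomorphism from a forbidden structure.  By counting, some
  colouring is not determined by relations of arity at most \<open>r\<close>, so in the generic lift two
  transversals carrying different sides are isomorphic; an automorphism matching them attaches both
  sides to one transversal, which is a copy of \<open>F\<close>.
\<close>

subsection \<open>Connected sets and their neighbourhoods\<close>

text \<open>The obstacle in the amalgam is that the vertices of a piece mapped beyond one side need
  not form a side of a minimal cut, so no new relation speaks about them. A connected set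
  \<open>K\<close> of such vertices is enlarged to a side \<open>M\<close> of a minimal cut lying
  inside the boundary of \<open>K\<close>. Either \<open>M\<close> is a strictly smaller piece and
  can be pulled back, or the boundary of the whole piece lies in the common part and what remains
  around \<open>K\<close> falls into smaller pieces, which can be moved to the other side. The
  induction therefore has to treat both sides of the amalgam at once.

  The class of lifts need not be closed under induced substructures, since a new tuple may lose the
  vertices that witness it. Amalgamation is thus carried out over partial isomorphisms between
  lifts, and finite sets are enlarged by witnesses before they are treated as structures.

  In the converse, the core property turns a homomorphism from \<open>F\<close> into the blow-up
  into a section of its projection to \<open>F\<close>, and a section would need both sides of the
  cut on one transversal.\<close>

definition nbr :: "'v rel \<Rightarrow> 'v set \<Rightarrow> 'v set" where
  "nbr G D = {v. v \<notin> D \<and> (\<exists>d\<in>D. (d, v) \<in> G)}"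

definition linked :: "'v rel \<Rightarrow> 'v set \<Rightarrow> bool" where
  "linked G D \<longleftrightarrow> D \<noteq> {} \<and> (\<forall>x\<in>D. \<forall>y\<in>D. (x, y) \<in> (Restr G D)\<^sup>*)"

text \<open>Only the steps of a path have to avoid \<open>S\<close>, so \<open>x \<in> S\<close>
  yields the singleton \<open>{x}\<close>; hence the side condition \<open>x \<notin> S\<close> in
  the facts on disjointness and boundary.\<close>

definition component :: "'v rel \<Rightarrow> 'v set \<Rightarrow> 'v \<Rightarrow> 'v set" where
  "component G S x = {y. (x, y) \<in> (Restr G (- S))\<^sup>*}"

text \<open>The full-component form of a minimal separator: the common neighbourhood is the cut, and
  \<open>D\<close>, \<open>E\<close> are two connected sides that both see all of it. It replaces
  the two chosen vertices in \<open>minimal_cut\<close>; \<open>minimal_cut_nbr\<close> and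
  \<open>minimal_cut_lobes\<close> translate.\<close>

definition lobes :: "'v rel \<Rightarrow> 'v set \<Rightarrow> 'v set \<Rightarrow> bool" where
  "lobes G D E \<longleftrightarrow> linked G D \<and> linked G E \<and> D \<inter> E = {} \<and> nbr G D = nbr G E"

lemma lobes_sym: "lobes G D E \<Longrightarrow> lobes G E D"
  by (auto simp: lobes_def)

lemma nbr_disjoint: "D \<inter> nbr G D = {}"
  by (auto simp: nbr_def)

text \<open>A path inside \<open>X\<close> that starts in \<open>D\<close> can leave
  \<open>D\<close> only through a vertex of \<open>nbr G D\<close>.\<close>

lemma linked_subset:
  assumes "linked G X" "X \<inter> D \<noteq> {}" "X \<inter> nbr G D = {}"
  shows "X \<subseteq> D"
proof
  fix y assume "y \<in> X"
  obtain x where x: "x \<in> X" "x \<in> D" using assms(2) by auto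
  have "(x, y) \<in> (Restr G X)\<^sup>*"
    using assms(1) x \<open>y \<in> X\<close> by (auto simp: linked_def)
  then show "y \<in> D"
  proof (induction rule: rtrancl_induct)
    case (step y z)
    then show ?case using assms(3) by (auto simp: nbr_def)
  qed (use x in simp)
qed

lemma component_self: "x \<in> component G S x"
  by (simp add: component_def)

lemma component_disjoint: "x \<notin> S \<Longrightarrow> component G S x \<inter> S = {}"
  by (auto simp: component_def elim: rtranclE)

lemma nbr_component: "x \<notin> S \<Longrightarrow> nbr G (component G S x) \<subseteq> S"
proof
  fix v assume "x \<notin> S" and v: "v \<in> nbr G (component G S x)"
  then obtain d where d: "d \<in> component G S x" "(d, v) \<in> G" "v \<notin> component G S x"
    by (auto simp: nbr_def)
  have "d \<notin> S" using d(1) component_disjoint[OF \<open>x \<notin> S\<close>] by blast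
  show "v \<in> S"
  proof (rule ccontr)
    assume "v \<notin> S"
    then have "(x, v) \<in> (Restr G (- S))\<^sup>*"
      using d(1,2) \<open>d \<notin> S\<close> by (auto simp: component_def intro: rtrancl.rtrancl_into_rtrancl)
    then show False using d(3) by (simp add: component_def)
  qed
qed

lemma linked_component:
  assumes "sym G"
  shows "linked G (component G S x)"
proof -
  let ?M = "component G S x"
  have *: "(x, y) \<in> (Restr G ?M)\<^sup>*" if "y \<in> ?M" for y
  proof -
    have "(x, y) \<in> (Restr G (- S))\<^sup>*" using that by (simp add: component_def)
    then show ?thesis
    proof (induction rule: rtrancl_induct)
      case (step y z)
      then have "y \<in> ?M" "z \<in> ?M"
        by (auto simp: component_def intro: rtrancl.rtrancl_into_rtrancl)
      with step show ?case by (auto intro: rtrancl.rtrancl_into_rtrancl)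
    qed simp
  qed
  have "sym ((Restr G ?M)\<^sup>*)"
    using assms by (intro sym_rtrancl) (auto simp: sym_def)
  then have "(y, z) \<in> (Restr G ?M)\<^sup>*" if "y \<in> ?M" "z \<in> ?M" for y z
    using *[OF that(1)] *[OF that(2)] by (meson rtrancl_trans symD)
  then show ?thesis using component_self by (fastforce simp: linked_def)
qed

text \<open>Let \<open>K\<close> grow to its component after deletion of \<open>nbr G E\<close>. No
  cut vertex loses its contact with this side, because each of them already has a neighbour in
  \<open>K\<close>.\<close>

lemma lobes_absorb:
  assumes "sym G" "linked G K" "linked G E" "E \<inter> K = {}" "nbr G E \<subseteq> nbr G K"
  shows "\<exists>M. K \<subseteq> M \<and> lobes G E M"
proof -
  obtain k where k: "k \<in> K" using assms(2) by (auto simp: linked_def)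
  have KE: "K \<inter> nbr G E = {}" using assms(5) nbr_disjoint by fast
  then have kE: "k \<notin> nbr G E" using k by auto
  let ?M = "component G (nbr G E) k"
  have M: "?M \<inter> nbr G E = {}" "nbr G ?M \<subseteq> nbr G E" "linked G ?M"
    using component_disjoint[OF kE] nbr_component[OF kE] linked_component[OF assms(1)] by auto
  have KM: "K \<subseteq> ?M"
    by (rule linked_subset[OF assms(2)]) (use M KE k component_self[of k] in blast)+
  have "nbr G E \<subseteq> nbr G ?M"
  proof
    fix v assume v: "v \<in> nbr G E"
    then have "v \<notin> ?M" using M by auto
    moreover have "\<exists>d\<in>?M. (d, v) \<in> G"
      using v assms(5) KM by (fastforce simp: nbr_def)
    ultimately show "v \<in> nbr G ?M" by (simp add: nbr_def)
  qed
  moreover have "E \<inter> ?M = {}"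
  proof (rule ccontr)
    assume "E \<inter> ?M \<noteq> {}"
    then have "?M \<subseteq> E" by (intro linked_subset[OF M(3)]) (use M in auto)
    then show False using KM k assms(4) by auto
  qed
  ultimately have "lobes G E ?M" using M assms(3) by (auto simp: lobes_def)
  then show ?thesis using KM by blast
qed

text \<open>Shrinks the neighbourhood of \<open>K\<close> to a minimal cut between \<open>K\<close> and \<open>E\<close>.\<close>

lemma lobes_separating:
  assumes "sym G" "linked G K" "linked G E" "E \<inter> (K \<union> nbr G K) = {}"
  shows "\<exists>K' M. lobes G M K' \<and> E \<subseteq> K' \<and> K \<subseteq> M \<and> nbr G M \<subseteq> nbr G K"
proof -
  obtain e where e: "e \<in> E" using assms(3) by (auto simp: linked_def)
  then have eK: "e \<notin> nbr G K" using assms(4) by auto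
  \<comment> \<open>The side of \<open>E\<close> beyond \<open>nbr G K\<close> has its whole
    boundary in \<open>nbr G K\<close>; this boundary is the minimal cut sought, and
    \<open>lobes_absorb\<close> lets \<open>K\<close> grow up to it.\<close>
  let ?K' = "component G (nbr G K) e"
  have K': "?K' \<inter> nbr G K = {}" "nbr G ?K' \<subseteq> nbr G K" "linked G ?K'"
    using component_disjoint[OF eK] nbr_component[OF eK] linked_component[OF assms(1)] by auto
  have E: "E \<subseteq> ?K'"
    by (rule linked_subset[OF assms(3)]) (use K' e component_self[of e] assms(4) in blast)+
  have "?K' \<inter> K = {}"
  proof (rule ccontr)
    assume "?K' \<inter> K \<noteq> {}"
    then have "?K' \<subseteq> K" by (intro linked_subset[OF K'(3)]) (use K' in auto)
    then show False using E e assms(4) by auto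
  qed
  from lobes_absorb[OF assms(1,2) K'(3) this K'(2)] obtain M
    where "K \<subseteq> M" "lobes G ?K' M" by blast
  then show ?thesis using E K'(2) lobes_sym by (metis lobes_def)
qed

subsection \<open>Gaifman graphs and minimal cuts\<close>

lemma sym_gaifman: "sym (gaifman A)"
  by (auto simp: gaifman_def sym_def)

lemma gaifman_subset: "structure_of \<Delta> A \<Longrightarrow> gaifman A \<subseteq> verts A \<times> verts A"
  by (fastforce simp: gaifman_def structure_of_def)

lemma nbr_subset_verts: "structure_of \<Delta> A \<Longrightarrow> nbr (gaifman A) D \<subseteq> verts A"
  using gaifman_subset by (fastforce simp: nbr_def)

text \<open>The entries of a tuple form a clique of the Gaifman graph, so no tuple reaches from
  \<open>D\<close> past its boundary. This locality is what allows a homomorphism to be changed on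
  \<open>D\<close> alone.\<close>

lemma tuple_subset:
  assumes "xs \<in> rel A i" "v \<in> set xs" "v \<in> D"
  shows "set xs \<subseteq> D \<union> nbr (gaifman A) D"
  using assms by (fastforce simp: nbr_def gaifman_def)

lemma component_subset_verts:
  assumes "structure_of \<Delta> A" "x \<in> verts A"
  shows "component (gaifman A) S x \<subseteq> verts A"
proof
  fix y assume "y \<in> component (gaifman A) S x"
  then have "(x, y) \<in> (Restr (gaifman A) (- S))\<^sup>*" by (simp add: component_def)
  then show "y \<in> verts A"
    by (induction rule: rtrancl_induct) (use assms gaifman_subset in auto)
qed

lemma separates_iff:
  assumes "structure_of \<Delta> A"
  shows "separates A C x y \<longleftrightarrow> C \<subseteq> verts A \<and> x \<in> verts A - C \<and> y \<in> verts A - C \<and>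
           y \<notin> component (gaifman A) C x"
proof -
  have "Restr (gaifman A) (verts A - C) = Restr (gaifman A) (- C)"
    using gaifman_subset[OF assms] by auto
  then show ?thesis by (simp add: separates_def component_def)
qed

text \<open>Every vertex \<open>c\<close> of the common neighbourhood has neighbours in both lobes,
  so as soon as \<open>c\<close> is not removed, \<open>D\<close> and \<open>E\<close> are joined
  through it.\<close>

lemma minimal_cut_nbr:
  assumes A: "structure_of \<Delta> A" and DE: "lobes (gaifman A) D E" "D \<subseteq> verts A" "E \<subseteq> verts A"
  shows "minimal_cut A (nbr (gaifman A) D)"
proof -
  let ?G = "gaifman A"
  have D: "linked ?G D" "linked ?G E" "D \<inter> E = {}" "nbr ?G D = nbr ?G E"
    using DE by (auto simp: lobes_def)
  obtain x y where xy: "x \<in> D" "y \<in> E" using D by (auto simp: linked_def)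
  have x: "x \<notin> nbr ?G D" "y \<notin> nbr ?G D" using xy D(4) by (auto simp: nbr_def)
  have "y \<notin> component ?G (nbr ?G D) x"
  proof
    assume y: "y \<in> component ?G (nbr ?G D) x"
    have "component ?G (nbr ?G D) x \<subseteq> D"
      using component_self[of x] xy component_disjoint[OF x(1)]
      by (intro linked_subset[OF linked_component[OF sym_gaifman]]) blast+
    then show False using y xy D by auto
  qed
  then have "separates A (nbr ?G D) x y"
    using xy DE x nbr_subset_verts[OF A] by (auto simp: separates_iff[OF A])
  moreover have "\<not> separates A C' x y" if C': "C' \<subset> nbr ?G D" for C'
  proof
    assume "separates A C' x y"
    then have x': "x \<notin> C'" and y': "y \<notin> component ?G C' x"
      by (auto simp: separates_iff[OF A])
    let ?M = "component ?G C' x"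
    obtain c where c: "c \<in> nbr ?G D" "c \<notin> C'" using C' by auto
    have M: "nbr ?G ?M \<subseteq> C'" by (rule nbr_component[OF x'])
    have "D \<subseteq> ?M"
      by (rule linked_subset[OF D(1)]) (use M C' xy component_self[of x] nbr_disjoint[of D] in blast)+
    then have "c \<in> ?M" using c M by (auto simp: nbr_def)
    moreover obtain d where d: "d \<in> E" "(d, c) \<in> ?G" using c D(4) by (auto simp: nbr_def)
    moreover have "d \<notin> C'" using d C' D(4) by (auto simp: nbr_def)
    ultimately have "d \<in> ?M" using M symD[OF sym_gaifman] by (fastforce simp: nbr_def)
    then have "E \<subseteq> ?M"
      by (intro linked_subset[OF D(2)]) (use M C' d D(4) nbr_disjoint[of E] in blast)+
    then show False using y' xy by auto
  qed
  ultimately show ?thesis unfolding minimal_cut_def by blast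
qed

text \<open>The lobes are the components of the two separated vertices. If one of them did not see
  all of \<open>C\<close>, its boundary would be a smaller set separating the same two
  vertices.\<close>

lemma minimal_cut_lobes:
  assumes A: "structure_of \<Delta> A" and "minimal_cut A C"
  obtains D E where "lobes (gaifman A) D E" "D \<subseteq> verts A" "E \<subseteq> verts A" "nbr (gaifman A) D = C"
proof -
  let ?G = "gaifman A"
  obtain x y where xy: "separates A C x y" "\<And>C'. C' \<subset> C \<Longrightarrow> \<not> separates A C' x y"
    using assms(2) by (auto simp: minimal_cut_def)
  then have x: "C \<subseteq> verts A" "x \<in> verts A" "y \<in> verts A" "x \<notin> C" "y \<notin> C"
      "y \<notin> component ?G C x"
    by (auto simp: separates_iff[OF A])
  \<comment> \<open>Giving back the vertices of \<open>C\<close> that do not touch the component of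
    \<open>u\<close> does not enlarge this component.\<close>
  have sub: "component ?G S u \<subseteq> component ?G C u"
    if "u \<notin> C" "nbr ?G (component ?G C u) = S" for u S
  proof (rule linked_subset[OF linked_component[OF sym_gaifman]])
    have "u \<notin> S" using that component_self[of u] by (auto simp: nbr_def)
    then show "component ?G S u \<inter> nbr ?G (component ?G C u) = {}"
      using that component_disjoint by metis
  qed (use component_self[of u] in blast)
  have symc: "v \<in> component ?G S u \<longleftrightarrow> u \<in> component ?G S v" for u v S
  proof -
    have "sym ((Restr ?G (- S))\<^sup>*)"
      using sym_gaifman[of A] by (intro sym_rtrancl) (auto simp: sym_def)
    then show ?thesis by (auto simp: component_def dest: symD)
  qed
  have nx: "nbr ?G (component ?G C x) = C"
  proof (rule ccontr)
    assume n: "nbr ?G (component ?G C x) \<noteq> C"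
    let ?S = "nbr ?G (component ?G C x)"
    have "?S \<subset> C" using n nbr_component[OF x(4)] by blast
    moreover from this have "separates A ?S x y"
      using x sub[OF x(4) refl] unfolding separates_iff[OF A] by blast
    ultimately show False using xy by auto
  qed
  have ny: "nbr ?G (component ?G C y) = C"
  proof (rule ccontr)
    assume n: "nbr ?G (component ?G C y) \<noteq> C"
    let ?S = "nbr ?G (component ?G C y)"
    have "?S \<subset> C" using n nbr_component[OF x(5)] by blast
    moreover from this have "separates A ?S x y"
      using x sub[OF x(5) refl] symc[of x _ y] unfolding separates_iff[OF A] by blast
    ultimately show False using xy by auto
  qed
  have "component ?G C x \<inter> component ?G C y = {}"
  proof (rule ccontr)
    assume "\<not> ?thesis"
    then obtain z where "(x, z) \<in> (Restr ?G (- C))\<^sup>*" "x \<in> component ?G C z" "z \<in> component ?G C y"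
      using symc[of _ C x] by (auto simp: component_def)
    then have "x \<in> component ?G C y" by (auto simp: component_def)
    then show False using x symc[of x C y] by auto
  qed
  then have "lobes ?G (component ?G C x) (component ?G C y)"
    using nx ny linked_component[OF sym_gaifman] by (auto simp: lobes_def)
  then show ?thesis
    using that[OF _ component_subset_verts[OF A x(2)] component_subset_verts[OF A x(3)] nx] by blast
qed

subsection \<open>Pieces and free amalgams\<close>

lemma component_eq:
  assumes "sym G" "y \<in> component G S x"
  shows "component G S y = component G S x"
proof -
  have "sym ((Restr G (- S))\<^sup>*)"
    using assms(1) by (intro sym_rtrancl) (auto simp: sym_def)
  moreover have "(x, y) \<in> (Restr G (- S))\<^sup>*" using assms(2) by (simp add: component_def)
  ultimately show ?thesis by (auto simp: component_def dest: symD intro: rtrancl_trans)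
qed

lemma hom_induced_iff:
  assumes "W \<subseteq> verts F"
  shows "is_hom (induced F W) A f \<longleftrightarrow>
    f ` W \<subseteq> verts A \<and> (\<forall>i xs. xs \<in> rel F i \<longrightarrow> set xs \<subseteq> W \<longrightarrow> map f xs \<in> rel A i)"
  using assms by (auto simp: is_hom_def induced_def Int_absorb1)

definition piece :: "'v rstruct \<Rightarrow> 'v set \<Rightarrow> 'v rstruct" where
  "piece F D = induced F (D \<union> nbr (gaifman F) D)"

text \<open>A piece is named by its side \<open>D\<close> instead of its cut, since one cut may have
  several sides. The opposite lobe \<open>E\<close> certifies that the boundary of \<open>D\<close>
  is a minimal cut.\<close>

definition is_piece :: "'v rstruct \<Rightarrow> 'v set \<Rightarrow> bool" where
  "is_piece F D \<longleftrightarrow> D \<subseteq> verts F \<and> (\<exists>E \<subseteq> verts F. lobes (gaifman F) D E)"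

text \<open>This is the new relation of the lift, read as a property of the map \<open>g\<close> on
  the cut, before any enumeration of the cut has been fixed.\<close>

definition extends :: "'v rstruct \<Rightarrow> 'v set \<Rightarrow> 'w rstruct \<Rightarrow> ('v \<Rightarrow> 'w) \<Rightarrow> bool" where
  "extends F D A g \<longleftrightarrow> (\<exists>f. is_hom (piece F D) A f \<and> (\<forall>v\<in>nbr (gaifman F) D. f v = g v))"

definition glue :: "'w rstruct \<Rightarrow> 'w rstruct \<Rightarrow> 'w rstruct" where
  "glue X Y = \<lparr>verts = verts X \<union> verts Y, rel = (\<lambda>i. rel X i \<union> rel Y i)\<rparr>"

text \<open>Agreement of the lifts on the common vertices as seen by a single \<open>F\<close>,
  phrased without new symbols so that the amalgam can be studied before the lift is defined.\<close>

definition compatible ::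
    "signature \<Rightarrow> 'v rstruct \<Rightarrow> 'w rstruct \<Rightarrow> 'w rstruct \<Rightarrow> bool" where
  "compatible \<Delta> F X Y \<longleftrightarrow> structure_of \<Delta> X \<and> structure_of \<Delta> Y \<and>
     (\<forall>i xs. set xs \<subseteq> verts X \<inter> verts Y \<longrightarrow> (xs \<in> rel X i \<longleftrightarrow> xs \<in> rel Y i)) \<and>
     (\<forall>D g. is_piece F D \<longrightarrow> g ` nbr (gaifman F) D \<subseteq> verts X \<inter> verts Y \<longrightarrow>
        (extends F D X g \<longleftrightarrow> extends F D Y g))"

lemma compatible_sym: "compatible \<Delta> F X Y \<Longrightarrow> compatible \<Delta> F Y X"
  unfolding compatible_def by (simp add: Int_commute)

lemma glue_commute: "glue X Y = glue Y X"
  by (auto simp: glue_def)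

lemma piece_hom_iff:
  assumes "structure_of \<Delta> F" "D \<subseteq> verts F"
  shows "is_hom (piece F D) A f \<longleftrightarrow>
    f ` (D \<union> nbr (gaifman F) D) \<subseteq> verts A \<and>
    (\<forall>i xs. xs \<in> rel F i \<longrightarrow> set xs \<subseteq> D \<union> nbr (gaifman F) D \<longrightarrow> map f xs \<in> rel A i)"
  unfolding piece_def using assms nbr_subset_verts[OF assms(1)] by (intro hom_induced_iff) blast

section \<open>Restricting, patching and recombining homomorphisms\<close>

lemma hom_into_side:
  assumes "compatible \<Delta> F X Y" "W \<subseteq> verts F" "is_hom (induced F W) (glue X Y) f"
    "f ` W \<subseteq> verts X"
  shows "is_hom (induced F W) X f"
proof -
  have "map f xs \<in> rel X i" if "xs \<in> rel F i" "set xs \<subseteq> W" for xs i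
  proof -
    have "map f xs \<in> rel X i \<or> map f xs \<in> rel Y i"
      using assms(2,3) that by (auto simp: hom_induced_iff glue_def)
    \<comment> \<open>A tuple of \<open>Y\<close> with all entries in \<open>X\<close> lies on the
      common vertices, where both sides have the same relations.\<close>
    moreover have "map f xs \<in> rel X i" if Y: "map f xs \<in> rel Y i"
    proof -
      have "set (map f xs) \<subseteq> verts Y"
        using Y assms(1) unfolding compatible_def structure_of_def by blast
      moreover have "set (map f xs) \<subseteq> verts X" using \<open>set xs \<subseteq> W\<close> assms(4) by auto
      ultimately show ?thesis using Y assms(1) unfolding compatible_def by blast
    qed
    ultimately show ?thesis by blast
  qed
  then show ?thesis using assms(2,4) by (auto simp: hom_induced_iff)
qed

text \<open>By \<open>tuple_subset\<close>, a tuple meeting \<open>D\<close> sees only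
  \<open>h\<close>, which equals \<open>f\<close> on the boundary, and every other tuple sees only
  \<open>f\<close>.\<close>

lemma hom_patch:
  assumes F: "structure_of \<Delta> F" and W: "W \<subseteq> verts F" "D \<union> nbr (gaifman F) D \<subseteq> W"
    and f: "is_hom (induced F W) A f" and h: "is_hom (piece F D) A h"
    and eq: "\<forall>v\<in>nbr (gaifman F) D. h v = f v"
  shows "is_hom (induced F W) A (\<lambda>v. if v \<in> D then h v else f v)"
proof -
  let ?f = "\<lambda>v. if v \<in> D then h v else f v"
  have D: "D \<subseteq> verts F" using W by auto
  note h' = h[unfolded piece_hom_iff[OF F D]] and f' = f[unfolded hom_induced_iff[OF W(1)]]
  have "map ?f xs \<in> rel A i" if xs: "xs \<in> rel F i" "set xs \<subseteq> W" for i xs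
  proof (cases "set xs \<inter> D = {}")
    case True
    then have "map ?f xs = map f xs" by auto
    then show ?thesis using f' xs by metis
  next
    case False
    then have sub: "set xs \<subseteq> D \<union> nbr (gaifman F) D" using tuple_subset[OF xs(1)] by blast
    then have "map ?f xs = map h xs" using eq by auto
    then show ?thesis using h' xs sub by metis
  qed
  moreover have "?f ` W \<subseteq> verts A" using h' f' by auto
  ultimately show ?thesis using W(1) by (auto simp: hom_induced_iff)
qed

text \<open>Outside \<open>K\<close> and its boundary, \<open>D\<close> decomposes into components
  attached only to \<open>nbr (gaifman F) K\<close>. No tuple meets two of them, so extensions of
  \<open>f\<close> chosen separately on the components fit together.\<close>

lemma hom_spread:
  fixes f :: "'v \<Rightarrow> 'w"
  assumes F: "structure_of \<Delta> F" and D: "D \<subseteq> verts F" "K \<subseteq> D"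
      "nbr (gaifman F) D \<subseteq> nbr (gaifman F) K"
    and f: "is_hom (piece F K) Y f"
    and h: "\<And>x. x \<in> D \<Longrightarrow> x \<notin> K \<Longrightarrow> x \<notin> nbr (gaifman F) K \<Longrightarrow>
      extends F (component (gaifman F) (nbr (gaifman F) K) x) Y f"
  shows "extends F D Y f"
proof -
  let ?G = "gaifman F"
  let ?c = "component ?G (nbr ?G K)"
  let ?B = "D - K - nbr ?G K"
  have "\<forall>x\<in>?B. \<exists>h. is_hom (piece F (?c x)) Y h \<and> (\<forall>v\<in>nbr ?G (?c x). h v = f v)"
    using h by (auto simp: extends_def)
  \<comment> \<open>The choice is made per component and not per vertex, so that all vertices of one
    component follow the same homomorphism.\<close>
  then have "\<forall>M\<in>?c ` ?B. \<exists>h. is_hom (piece F M) Y h \<and> (\<forall>v\<in>nbr ?G M. h v = f v)"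
    by auto
  from bchoice[OF this] obtain H where
    "\<forall>M\<in>?c ` ?B. is_hom (piece F M) Y (H M) \<and> (\<forall>v\<in>nbr ?G M. H M v = f v)"
    by blast
  then have H: "is_hom (piece F (?c x)) Y (H (?c x))" "\<forall>v\<in>nbr ?G (?c x). H (?c x) v = f v"
    if "x \<in> ?B" for x using that by auto
  define f' where "f' v = (if v \<in> K \<union> nbr ?G K then f v else H (?c v) v)" for v
  have K: "K \<subseteq> verts F" using D by auto
  note fK = f[unfolded piece_hom_iff[OF F K]]
  have on_c: "f' v = H (?c x) v" if x: "x \<in> ?B" and v: "v \<in> ?c x \<union> nbr ?G (?c x)" for x v
  proof (cases "v \<in> ?c x")
    case True
    have "?c x \<inter> nbr ?G K = {}" using x by (intro component_disjoint) auto
    moreover have "?c x \<inter> K = {}"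
    proof (rule ccontr)
      assume "?c x \<inter> K \<noteq> {}"
      then have "?c x \<subseteq> K"
        using \<open>?c x \<inter> nbr ?G K = {}\<close>
        by (intro linked_subset[OF linked_component[OF sym_gaifman]]) auto
      then show False using x component_self[of x] by blast
    qed
    ultimately show ?thesis using True component_eq[OF sym_gaifman True] by (auto simp: f'_def)
  next
    case False
    then have "v \<in> nbr ?G (?c x)" using v by auto
    moreover from this have "v \<in> nbr ?G K" using nbr_component[of x] x by blast
    ultimately show ?thesis using H(2)[OF x] by (auto simp: f'_def)
  qed
  have cF: "?c x \<subseteq> verts F" if "x \<in> ?B" for x
    using component_subset_verts[OF F] that D by blast
  have "map f' xs \<in> rel Y i"
    if xs: "xs \<in> rel F i" "set xs \<subseteq> D \<union> nbr ?G D" for i xs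
  proof (cases "set xs \<inter> ?B = {}")
    case True
    then have s: "set xs \<subseteq> K \<union> nbr ?G K" using xs D by auto
    then have "map f' xs = map f xs" by (auto simp: f'_def)
    then show ?thesis using fK xs s by metis
  next
    case False
    then obtain x where x: "x \<in> set xs" "x \<in> ?B" by auto
    have s: "set xs \<subseteq> ?c x \<union> nbr ?G (?c x)"
      using tuple_subset[OF xs(1) x(1) component_self] .
    then have eq: "map f' xs = map (H (?c x)) xs" using on_c[OF x(2)] by auto
    have "map (H (?c x)) xs \<in> rel Y i"
      using H(1)[OF x(2)] xs s unfolding piece_hom_iff[OF F cF[OF x(2)]] by blast
    then show ?thesis unfolding eq .
  qed
  moreover have "f' v \<in> verts Y" if v: "v \<in> D \<union> nbr ?G D" for v
  proof (cases "v \<in> ?B")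
    case True
    then have "f' v = H (?c v) v" using on_c component_self[of v] by blast
    then show ?thesis
      using H(1)[OF True] cF[OF True] component_self[of v] by (auto simp: piece_hom_iff[OF F])
  next
    case False
    then have "v \<in> K \<union> nbr ?G K" using v D by auto
    then show ?thesis using fK by (auto simp: f'_def)
  qed
  moreover have "f' v = f v" if "v \<in> nbr ?G D" for v using that D by (auto simp: f'_def)
  ultimately show ?thesis unfolding extends_def piece_hom_iff[OF F D(1)] by blast
qed

text \<open>\<open>K\<close> is a connected component of the vertices of \<open>D\<close> mapped
  outside \<open>X\<close>. A tuple meeting \<open>K\<close> has an image with an entry outside
  \<open>X\<close>, so this image comes from \<open>Y\<close>; the boundary of \<open>K\<close> is
  therefore mapped into both sides.\<close>

lemma outside_part:
  assumes F: "structure_of \<Delta> F" and D: "D \<subseteq> verts F"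
    and XY: "compatible \<Delta> F X Y"
    and f: "is_hom (piece F D) (glue X Y) f" "f ` nbr (gaifman F) D \<subseteq> verts X"
    and x: "x \<in> D" "f x \<notin> verts X"
  obtains K where "linked (gaifman F) K" "K \<subseteq> D" "f ` K \<inter> verts X = {}"
    "f ` nbr (gaifman F) K \<subseteq> verts X \<inter> verts Y" "is_hom (piece F K) Y f"
proof -
  let ?G = "gaifman F"
  define W where "W = {v \<in> D. f v \<notin> verts X}"
  \<comment> \<open>Deleting the complement of \<open>W\<close> leaves the component of
    \<open>x\<close> inside \<open>W\<close>.\<close>
  define K where "K = component ?G (- W) x"
  have xW: "x \<notin> - W" using x by (auto simp: W_def)
  have KW: "K \<subseteq> W" using component_disjoint[OF xW] by (auto simp: K_def)
  have nW: "nbr ?G K \<inter> W = {}" using nbr_component[OF xW] by (auto simp: K_def)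
  have KD: "K \<subseteq> D" using KW by (auto simp: W_def)
  have nD: "nbr ?G K \<subseteq> D \<union> nbr ?G D" using KD by (auto simp: nbr_def)
  note f' = f(1)[unfolded piece_hom_iff[OF F D]]
  have toY: "map f xs \<in> rel Y i" if xs: "xs \<in> rel F i" "set xs \<inter> K \<noteq> {}" for xs i
  proof -
    obtain k where k: "k \<in> set xs" "k \<in> K" using xs by auto
    have "set xs \<subseteq> D \<union> nbr ?G D" using tuple_subset[OF xs(1) k(1)] k KD by blast
    then have "map f xs \<in> rel X i \<or> map f xs \<in> rel Y i" using f' xs by (auto simp: glue_def)
    moreover have "map f xs \<notin> rel X i"
    proof
      assume "map f xs \<in> rel X i"
      then have "set (map f xs) \<subseteq> verts X"
        using XY unfolding compatible_def structure_of_def by blast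
      then show False using k KW by (auto simp: W_def)
    qed
    ultimately show ?thesis by blast
  qed
  have nX: "f v \<in> verts X" if "v \<in> nbr ?G K" for v
    using that nW nD f(2) by (auto simp: W_def)
  have nY: "f v \<in> verts Y" if "v \<in> nbr ?G K" for v
  proof -
    from that obtain k i xs where "k \<in> K" "xs \<in> rel F i" "k \<in> set xs" "v \<in> set xs"
      by (auto simp: nbr_def gaifman_def)
    then have "map f xs \<in> rel Y i" using toY by auto
    then have "set (map f xs) \<subseteq> verts Y"
      using XY unfolding compatible_def structure_of_def by blast
    then show ?thesis using \<open>v \<in> set xs\<close> by auto
  qed
  have KY: "f v \<in> verts Y" if "v \<in> K" for v
    using that f' KW KD by (auto simp: glue_def W_def)
  have KF: "K \<subseteq> verts F" using KD D by auto
  have "is_hom (piece F K) (glue Y X) f"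
    unfolding piece_hom_iff[OF F KF]
    using f' KD nD by (fastforce simp: glue_def)
  then have "is_hom (piece F K) Y f"
    using hom_into_side[OF compatible_sym[OF XY], of "K \<union> nbr ?G K" f] nY KY KF nbr_subset_verts[OF F]
    by (auto simp: piece_def)
  moreover have "linked ?G K" unfolding K_def by (rule linked_component[OF sym_gaifman])
  moreover have "f ` K \<inter> verts X = {}" using KW by (auto simp: W_def)
  moreover have "f ` nbr ?G K \<subseteq> verts X \<inter> verts Y" using nX nY by blast
  ultimately show ?thesis using that KD by blast
qed

text \<open>Supplies the opposite lobe, namely one around \<open>K\<close>, which makes the
  components left over in \<open>hom_spread\<close> pieces to which facts about pieces
  apply.\<close>

lemma component_lobes:
  assumes K: "linked (gaifman F) K" and x: "x \<notin> K" "x \<notin> nbr (gaifman F) K"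
  shows "\<exists>M. K \<subseteq> M \<and> lobes (gaifman F) (component (gaifman F) (nbr (gaifman F) K) x) M"
proof (rule lobes_absorb[OF sym_gaifman K linked_component[OF sym_gaifman]])
  let ?c = "component (gaifman F) (nbr (gaifman F) K) x"
  show "nbr (gaifman F) ?c \<subseteq> nbr (gaifman F) K" using x by (intro nbr_component) auto
  show "?c \<inter> K = {}"
  proof (rule ccontr)
    assume "?c \<inter> K \<noteq> {}"
    then have "?c \<subseteq> K"
      using component_disjoint[OF x(2)]
      by (intro linked_subset[OF linked_component[OF sym_gaifman]]) auto
    then show False using x component_self[of x] by blast
  qed
qed

lemma lobes_sub_verts:
  assumes "structure_of \<Delta> F" "linked (gaifman F) M" "M \<inter> verts F \<noteq> {}"
  shows "M \<subseteq> verts F"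
proof -
  have "M \<inter> nbr (gaifman F) (verts F) = {}" 
    using nbr_subset_verts[OF assms(1)] nbr_disjoint[of "verts F"] by blast
  then show ?thesis using linked_subset[OF assms(2,3)] by blast
qed

text \<open>Among the homomorphisms with the prescribed values on the cut, take one with the fewest
  vertices outside \<open>X\<close>. If some vertex is outside, a smaller piece can be redirected
  into \<open>X\<close>, against minimality, or the whole piece can be moved into \<open>Y\<close>,
  from where compatibility returns it to \<open>X\<close>. The sides exchange roles in the second
  case, so \<open>X\<close>, \<open>Y\<close> and \<open>g\<close> vary in the induction.\<close>

lemma extends_glue:
  assumes F: "structure_of \<Delta> F" "finite (verts F)"
  shows "compatible \<Delta> F X Y \<Longrightarrow> is_piece F D \<Longrightarrow> extends F D (glue X Y) g \<Longrightarrow>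
    g ` nbr (gaifman F) D \<subseteq> verts X \<Longrightarrow> extends F D X g"
proof (induction "card D" arbitrary: D X Y g rule: less_induct)
  case less
  let ?G = "gaifman F"
  note XY = less.prems(1)
  have D: "D \<subseteq> verts F" using less.prems(2) by (simp add: is_piece_def)
  have finD: "finite D" using D F(2) finite_subset by blast
  obtain E where E: "E \<subseteq> verts F" "lobes ?G D E" using less.prems(2) by (auto simp: is_piece_def)
  have smaller: "card M < card D" if "M \<subset> D" for M using psubset_card_mono finD that by blast
  define out where "out f = card {v \<in> D. f v \<notin> verts X}" for f
  define good where "good f \<longleftrightarrow> is_hom (piece F D) (glue X Y) f \<and> (\<forall>v\<in>nbr ?G D. f v = g v)" for f
  have "\<exists>f. good f" using less.prems(3) by (auto simp: extends_def good_def)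
  then obtain f where f: "good f" and least: "\<And>f'. good f' \<Longrightarrow> out f \<le> out f'"
    using ex_has_least_nat[of good _ out] by blast
  have fR: "f ` nbr ?G D \<subseteq> verts X" using f less.prems(4) by (auto simp: good_def)
  show ?case
  proof (cases "\<exists>x\<in>D. f x \<notin> verts X")
    case False
    then have "f ` (D \<union> nbr ?G D) \<subseteq> verts X" using fR by blast
    then have "is_hom (piece F D) X f"
      using f hom_into_side[OF XY, of "D \<union> nbr ?G D" f] D nbr_subset_verts[OF F(1)]
      by (auto simp: piece_def good_def)
    then show ?thesis using f by (auto simp: extends_def good_def)
  next
    case True
    then obtain x where x: "x \<in> D" "f x \<notin> verts X" by auto
    obtain K where K: "linked ?G K" "K \<subseteq> D" "f ` K \<inter> verts X = {}"
        "f ` nbr ?G K \<subseteq> verts X \<inter> verts Y" "is_hom (piece F K) Y f"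
      using outside_part[OF F(1) D XY _ fR x] f good_def by blast
    have lE: "linked ?G E" "linked ?G D" "D \<inter> E = {}" "nbr ?G D = nbr ?G E"
      using E by (auto simp: lobes_def)
    have "E \<inter> nbr ?G K \<subseteq> nbr ?G D" using K(2) lE(3) by (auto simp: nbr_def)
    then have "E \<inter> (K \<union> nbr ?G K) = {}" using K(2) lE(3,4) nbr_disjoint[of E] by blast
    from lobes_separating[OF sym_gaifman K(1) lE(1) this] obtain K' M where
      M: "lobes ?G M K'" "E \<subseteq> K'" "K \<subseteq> M" "nbr ?G M \<subseteq> nbr ?G K" by blast
    have lM: "linked ?G M" "linked ?G K'" "M \<inter> K' = {}" "nbr ?G M = nbr ?G K'"
      using M by (auto simp: lobes_def)
    have K0: "K \<noteq> {}" "E \<noteq> {}" using K lE by (auto simp: linked_def)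
    \<comment> \<open>The boundary of \<open>D\<close> is also that of \<open>E\<close>, hence
      adjacent to \<open>K'\<close>; it lies in \<open>K'\<close> or in the cut and thus misses
      \<open>M\<close>. This confines \<open>M\<close> to \<open>D\<close>.\<close>
    have "nbr ?G D \<subseteq> K' \<union> nbr ?G K'"
      using lE(4) M(2) by (auto simp: nbr_def)
    then have "M \<inter> nbr ?G D = {}" using lM nbr_disjoint[of M] by blast
    then have MD: "M \<subseteq> D" using linked_subset[OF lM(1)] K0 K(2) M(3) by blast
    have MF: "M \<subseteq> verts F" using MD D by auto
    have "K' \<subseteq> verts F"
      using lobes_sub_verts[OF F(1) lM(2)] M(2) E(1) K0 by blast
    then have pM: "is_piece F M" using M(1) MF by (auto simp: is_piece_def)
    show ?thesis
    proof (cases "M = D")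
      case False
      then have cM: "card M < card D" using smaller MD by blast
      have DnF: "D \<union> nbr ?G D \<subseteq> verts F" using D nbr_subset_verts[OF F(1)] by blast
      have MnD: "M \<union> nbr ?G M \<subseteq> D \<union> nbr ?G D" using MD by (auto simp: nbr_def)
      have "is_hom (piece F M) (glue X Y) f"
        using f MnD unfolding good_def piece_hom_iff[OF F(1) D] piece_hom_iff[OF F(1) MF] by blast
      then have "extends F M (glue X Y) f" by (auto simp: extends_def)
      then have "extends F M X f"
        using less.hyps[OF cM XY pM] K(4) M(4) by blast
      then obtain h where h: "is_hom (piece F M) X h" "\<forall>v\<in>nbr ?G M. h v = f v"
        by (auto simp: extends_def)
      have hg: "is_hom (piece F M) (glue X Y) h" using h(1) by (auto simp: is_hom_def glue_def)
      define f' where "f' v = (if v \<in> M then h v else f v)" for v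
      have "good f'"
        using hom_patch[OF F(1) DnF MnD _ hg h(2)] f MD nbr_disjoint[of D]
        unfolding good_def piece_def[of F D] f'_def by auto
      moreover have "{v \<in> D. f' v \<notin> verts X} \<subset> {v \<in> D. f v \<notin> verts X}"
      proof -
        have "f' v \<in> verts X" if "v \<in> M" for v
          using that h(1) by (auto simp: f'_def piece_hom_iff[OF F(1) MF])
        then have "{v \<in> D. f' v \<notin> verts X} \<subseteq> {v \<in> D. f v \<notin> verts X} - K"
          using M(3) by (auto simp: f'_def)
        moreover have "K \<subseteq> {v \<in> D. f v \<notin> verts X}" using K(2,3) by auto
        ultimately show ?thesis using K0 by blast
      qed
      then have "out f' < out f" unfolding out_def using finD by (intro psubset_card_mono) auto
      ultimately show ?thesis using least by fastforce
    next
      \<comment> \<open>Here the boundary of \<open>D\<close> is contained in that of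
        \<open>K\<close> and is mapped into both sides. All other components of \<open>D\<close> are
        smaller pieces, so the induction hypothesis with the sides exchanged carries them into
        \<open>Y\<close>.\<close>
      case eq: True
      have nDK: "nbr ?G D \<subseteq> nbr ?G K" using M(4) eq by simp
      have "extends F D Y f"
      proof (rule hom_spread[OF F(1) D K(2) nDK K(5)])
        fix x assume x: "x \<in> D" "x \<notin> K" "x \<notin> nbr ?G K"
        let ?c = "component ?G (nbr ?G K) x"
        obtain M' where M': "K \<subseteq> M'" "lobes ?G ?c M'" using component_lobes[OF K(1) x(2,3)] by blast
        have nc: "nbr ?G ?c \<subseteq> nbr ?G K" using x by (intro nbr_component) auto
        have "?c \<inter> nbr ?G D = {}" using component_disjoint[OF x(3)] nDK by blast
        moreover have "?c \<inter> D \<noteq> {}" using x(1) component_self[of x ?G "nbr ?G K"] by blast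
        ultimately have cD: "?c \<subseteq> D"
          by (intro linked_subset[OF linked_component[OF sym_gaifman]])
        have cF: "?c \<subseteq> verts F" using cD D by auto
        have "?c \<inter> K = {}" using M' by (auto simp: lobes_def)
        then have "?c \<subset> D" using K0 K(2) cD by blast
        then have cc: "card ?c < card D" by (rule smaller)
        have "linked ?G M'" using M'(2) by (simp add: lobes_def)
        then have "M' \<subseteq> verts F"
          using lobes_sub_verts[OF F(1)] M'(1) K0 K(2) D by blast
        then have pc: "is_piece F ?c" using M'(2) cF by (auto simp: is_piece_def)
        have "?c \<union> nbr ?G ?c \<subseteq> D \<union> nbr ?G D" using cD by (auto simp: nbr_def)
        then have "is_hom (piece F ?c) (glue X Y) f"
          using f unfolding good_def piece_hom_iff[OF F(1) D] piece_hom_iff[OF F(1) cF] by blast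
        then have "extends F ?c (glue Y X) f" by (auto simp: extends_def glue_commute)
        then show "extends F ?c Y f"
          using less.hyps[OF cc compatible_sym[OF XY] pc] nc K(4) by blast
      qed
      moreover have "f ` nbr ?G D \<subseteq> verts X \<inter> verts Y" using nDK K(4) by blast
      ultimately have "extends F D X f"
        using XY less.prems(2) unfolding compatible_def by blast
      then show ?thesis using f by (auto simp: extends_def good_def)
    qed
  qed
qed

lemma piece_all: "structure_of \<Delta> F \<Longrightarrow> nbr (gaifman F) (verts F) = {}"
  using nbr_subset_verts[of \<Delta> F "verts F"] nbr_disjoint[of "verts F" "gaifman F"] by blast

lemma piece_verts:
  assumes "structure_of \<Delta> F"
  shows "is_hom (piece F (verts F)) A f \<longleftrightarrow> is_hom F A f"
proof -
  have "set xs \<subseteq> verts F" if "xs \<in> rel F i" for xs i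
    using assms that unfolding structure_of_def by blast
  then show ?thesis
    unfolding piece_hom_iff[OF assms subset_refl] piece_all[OF assms]
    by (auto simp: is_hom_def)
qed

text \<open>The whole of \<open>F\<close> behaves like a piece with empty cut, but it has no
  opposite lobe. The second case of \<open>extends_glue\<close> still works: around a part
  \<open>K\<close> outside \<open>X\<close>, all remaining components are pieces and can be moved
  into \<open>Y\<close>.\<close>

lemma hom_glue:
  assumes F: "structure_of \<Delta> F" "finite (verts F)" "connected_structure F"
    and XY: "compatible \<Delta> F X Y" and f: "is_hom F (glue X Y) f"
  shows "\<exists>f'. is_hom F X f' \<or> is_hom F Y f'"
proof (cases "\<exists>x\<in>verts F. f x \<notin> verts X")
  case False
  then show ?thesis
    using hom_into_side[OF XY, of "verts F" f] f piece_verts[OF F(1)] piece_all[OF F(1)]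
    by (auto simp: piece_def)
next
  case True
  let ?G = "gaifman F"
  obtain x where x: "x \<in> verts F" "f x \<notin> verts X" using True by auto
  obtain K where K: "linked ?G K" "K \<subseteq> verts F" "f ` K \<inter> verts X = {}"
      "f ` nbr ?G K \<subseteq> verts X \<inter> verts Y" "is_hom (piece F K) Y f"
    using outside_part[of \<Delta> F "verts F" X Y f x, OF F(1) subset_refl XY _ _ x]
      f piece_all[OF F(1)] piece_verts[OF F(1)]
    by (metis empty_subsetI image_empty)
  have "extends F (verts F) Y f"
  proof (rule hom_spread[OF F(1) subset_refl K(2) _ K(5)])
    fix x assume x: "x \<in> verts F" "x \<notin> K" "x \<notin> nbr ?G K"
    let ?c = "component ?G (nbr ?G K) x"
    obtain M' where M': "K \<subseteq> M'" "lobes ?G ?c M'" using component_lobes[OF K(1) x(2,3)] by blast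
    have nc: "nbr ?G ?c \<subseteq> nbr ?G K" using x by (intro nbr_component) auto
    have cF: "?c \<subseteq> verts F" using component_subset_verts[OF F(1) x(1)] .
    have "linked ?G M'" "K \<noteq> {}" using M'(2) K(1) by (auto simp: lobes_def linked_def)
    then have "M' \<subseteq> verts F"
      using lobes_sub_verts[OF F(1)] M'(1) K(2) by blast
    then have pc: "is_piece F ?c" using M'(2) cF by (auto simp: is_piece_def)
    have "f v \<in> verts (glue Y X)" if "v \<in> verts F" for v
      using f that by (auto simp: is_hom_def glue_def)
    moreover have "map f xs \<in> rel (glue Y X) i" if "xs \<in> rel F i" for xs i
      using f that by (auto simp: is_hom_def glue_def)
    ultimately have "is_hom (piece F ?c) (glue Y X) f"
      using cF nbr_subset_verts[OF F(1)] unfolding piece_hom_iff[OF F(1) cF] by blast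
    then have "extends F ?c (glue Y X) f" by (auto simp: extends_def)
    then show "extends F ?c Y f"
      using extends_glue[OF F(1,2) compatible_sym[OF XY] pc] nc K(4) by blast
  qed (simp add: piece_all[OF F(1)])
  then show ?thesis using piece_verts[OF F(1)] by (auto simp: extends_def)
qed

lemma extends_glue_iff:
  assumes F: "structure_of \<Delta> F" "finite (verts F)"
    and "compatible \<Delta> F X Y" "is_piece F D" "g ` nbr (gaifman F) D \<subseteq> verts X"
  shows "extends F D (glue X Y) g \<longleftrightarrow> extends F D X g"
proof
  have "is_hom P (glue X Y) f" if "is_hom P X f" for f and P :: "'a rstruct"
    using that by (auto simp: is_hom_def glue_def)
  then show "extends F D X g \<Longrightarrow> extends F D (glue X Y) g"
    unfolding extends_def by blast
qed (rule extends_glue[OF assms(1-4) _ assms(5)])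

subsection \<open>Partial isomorphisms\<close>

definition image_structure :: "('v \<Rightarrow> 'w) \<Rightarrow> 'v rstruct \<Rightarrow> 'w rstruct" where
  "image_structure h A = \<lparr>verts = h ` verts A, rel = (\<lambda>i. map h ` rel A i)\<rparr>"

lemma image_structure_rel:
  assumes "structure_of \<Delta> A" "inj_on h (verts A)" "set xs \<subseteq> verts A"
  shows "map h xs \<in> rel (image_structure h A) i \<longleftrightarrow> xs \<in> rel A i"
proof
  assume "map h xs \<in> rel (image_structure h A) i"
  then obtain ys where ys: "ys \<in> rel A i" "map h xs = map h ys"
    by (auto simp: image_structure_def)
  then have "set ys \<subseteq> verts A" using assms(1) by (auto simp: structure_of_def)
  then have "inj_on h (set xs \<union> set ys)" using assms(3) by (intro inj_on_subset[OF assms(2)]) auto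
  then have "xs = ys" using ys(2) by (simp add: inj_on_map_eq_map)
  then show "xs \<in> rel A i" using ys by simp
qed (auto simp: image_structure_def)

lemma image_structure_of: "structure_of \<Delta> A \<Longrightarrow> structure_of \<Delta> (image_structure h A)"
  by (fastforce simp: structure_of_def image_structure_def)

lemma hom_comp: "is_hom A B f \<Longrightarrow> is_hom B C g \<Longrightarrow> is_hom A C (g \<circ> f)"
  unfolding is_hom_def by (metis image_comp image_mono list.map_comp subset_trans)

lemma hom_image: "is_hom A (image_structure h A) h"
  by (auto simp: is_hom_def image_structure_def)

lemma hom_image_inv:
  assumes "structure_of \<Delta> A" "inj_on h (verts A)"
  shows "is_hom (image_structure h A) A (inv_into (verts A) h)"
proof -
  have "map (inv_into (verts A) h) (map h xs) = xs" if "xs \<in> rel A i" for xs i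
  proof -
    have "set xs \<subseteq> verts A" using that assms by (auto simp: structure_of_def)
    then show ?thesis using assms(2) by (auto intro!: map_idI)
  qed
  then show ?thesis using assms(2) by (auto simp: is_hom_def image_structure_def)
qed

text \<open>A partial isomorphism is kept as a set of pairs, so that reversing it is taking the
  converse. Tuples are tested through lists of pairs; the empty list makes even the empty
  \<open>p\<close> compare nullary tuples.\<close>

definition piso :: "'v rstruct \<Rightarrow> 'w rstruct \<Rightarrow> ('v \<times> 'w) set \<Rightarrow> bool" where
  "piso X Y p \<longleftrightarrow> p \<subseteq> verts X \<times> verts Y \<and>
     (\<forall>u\<in>p. \<forall>v\<in>p. fst u = fst v \<longleftrightarrow> snd u = snd v) \<and>
     (\<forall>i zs. set zs \<subseteq> p \<longrightarrow> (map fst zs \<in> rel X i \<longleftrightarrow> map snd zs \<in> rel Y i))"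

lemma piso_converse:
  assumes "piso X Y p"
  shows "piso Y X (p\<inverse>)"
proof -
  have "map fst zs \<in> rel Y i \<longleftrightarrow> map snd zs \<in> rel X i" if "set zs \<subseteq> p\<inverse>" for i zs
  proof -
    have "set (map prod.swap zs) \<subseteq> p" using that by auto
    then have "map fst (map prod.swap zs) \<in> rel X i \<longleftrightarrow> map snd (map prod.swap zs) \<in> rel Y i"
      using assms unfolding piso_def by blast
    then show ?thesis by (simp add: comp_def)
  qed
  moreover have "p\<inverse> \<subseteq> verts Y \<times> verts X" using assms by (auto simp: piso_def)
  moreover have "fst u = fst v \<longleftrightarrow> snd u = snd v" if "u \<in> p\<inverse>" "v \<in> p\<inverse>" for u v
  proof -
    have "prod.swap u \<in> p" "prod.swap v \<in> p" using that by auto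
    then have "fst (prod.swap u) = fst (prod.swap v) \<longleftrightarrow> snd (prod.swap u) = snd (prod.swap v)"
      using assms unfolding piso_def by blast
    then show ?thesis by auto
  qed
  ultimately show ?thesis by (simp add: piso_def)
qed

lemma piso_subset: "piso X Y p \<Longrightarrow> q \<subseteq> p \<Longrightarrow> piso X Y q"
  unfolding piso_def by blast

lemma piso_cong:
  assumes "piso X Y p" "p \<subseteq> verts X' \<times> verts Y'"
    and X: "\<And>i xs. set xs \<subseteq> Domain p \<Longrightarrow> xs \<in> rel X i \<longleftrightarrow> xs \<in> rel X' i"
    and Y: "\<And>i xs. set xs \<subseteq> Range p \<Longrightarrow> xs \<in> rel Y i \<longleftrightarrow> xs \<in> rel Y' i"
  shows "piso X' Y' p"
proof -
  have "map fst zs \<in> rel X' i \<longleftrightarrow> map snd zs \<in> rel Y' i" if "set zs \<subseteq> p" for i zs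
  proof -
    have "set (map fst zs) \<subseteq> Domain p" "set (map snd zs) \<subseteq> Range p" using that by force+
    then have "map fst zs \<in> rel X' i \<longleftrightarrow> map fst zs \<in> rel X i"
        "map snd zs \<in> rel Y' i \<longleftrightarrow> map snd zs \<in> rel Y i"
      using X Y by blast+
    then show ?thesis using assms(1) that unfolding piso_def by blast
  qed
  then show ?thesis using assms(1,2) unfolding piso_def by blast
qed

lemma embedding_of_piso:
  assumes p: "piso X Y p" "Domain p = verts X"
  obtains f where "is_embedding X Y f" "\<forall>x\<in>verts X. (x, f x) \<in> p"
proof -
  have "\<forall>x\<in>verts X. \<exists>y. (x, y) \<in> p" using p(2) by auto
  from bchoice[OF this] obtain f where f: "\<forall>x\<in>verts X. (x, f x) \<in> p" by blast
  have "inj_on f (verts X)"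
  proof (rule inj_onI)
    fix x y assume "x \<in> verts X" "y \<in> verts X" "f x = f y"
    then have "(x, f x) \<in> p" "(y, f y) \<in> p" using f by auto
    then show "x = y" using p(1) \<open>f x = f y\<close> unfolding piso_def by (metis fst_conv snd_conv)
  qed
  moreover have "f ` verts X \<subseteq> verts Y" using f p(1) by (auto simp: piso_def)
  moreover have "xs \<in> rel X i \<longleftrightarrow> map f xs \<in> rel Y i" if "set xs \<subseteq> verts X" for xs i
  proof -
    have "set (map (\<lambda>x. (x, f x)) xs) \<subseteq> p" using that f by auto
    then have "map fst (map (\<lambda>x. (x, f x)) xs) \<in> rel X i \<longleftrightarrow> map snd (map (\<lambda>x. (x, f x)) xs) \<in> rel Y i"
      using p(1) unfolding piso_def by blast
    then show ?thesis by (simp add: comp_def)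
  qed
  ultimately have "is_embedding X Y f" by (simp add: is_embedding_def)
  then show ?thesis using f by (rule that)
qed

lemma piso_of_embedding:
  assumes "is_embedding X Y f"
  shows "piso X Y ((\<lambda>x. (x, f x)) ` verts X)"
proof -
  have "map fst zs \<in> rel X i \<longleftrightarrow> map snd zs \<in> rel Y i"
    if z: "set zs \<subseteq> (\<lambda>x. (x, f x)) ` verts X" for i zs
  proof -
    have "snd u = f (fst u) \<and> fst u \<in> verts X" if "u \<in> set zs" for u using z that by force
    then have eq: "map snd zs = map f (map fst zs)" and "set (map fst zs) \<subseteq> verts X" by auto
    then show ?thesis using assms unfolding is_embedding_def eq by blast
  qed
  moreover have "inj_on f (verts X)" "f ` verts X \<subseteq> verts Y"
    using assms unfolding is_embedding_def by blast+
  ultimately show ?thesis by (auto simp: piso_def inj_on_eq_iff)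
qed

section \<open>Back-and-forth along countable chains of finite partial isomorphisms\<close>

lemma piso_UN:
  assumes "\<And>n::nat. piso X Y (s n)" "\<And>n. s n \<subseteq> s (Suc n)"
  shows "piso X Y (\<Union>n. s n)"
proof -
  have mono: "s m \<subseteq> s n" if "m \<le> n" for m n
    using lift_Suc_mono_le[of s, OF assms(2) that] .
  have fin: "\<exists>n. Z \<subseteq> s n" if "finite Z" "Z \<subseteq> (\<Union>n. s n)" for Z
    using that
  proof (induction Z)
    case (insert z Z)
    then obtain m n where "Z \<subseteq> s m" "z \<in> s n" by auto
    then have "insert z Z \<subseteq> s (max m n)" using mono[of m "max m n"] mono[of n "max m n"] by auto
    then show ?case by blast
  qed simp
  have "fst u = fst v \<longleftrightarrow> snd u = snd v" if "u \<in> (\<Union>n. s n)" "v \<in> (\<Union>n. s n)" for u v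
  proof -
    have "finite {u, v}" "{u, v} \<subseteq> (\<Union>n. s n)" using that by auto
    then obtain n where "{u, v} \<subseteq> s n" using fin by blast
    then show ?thesis using assms(1)[of n] by (simp add: piso_def)
  qed
  moreover have "map fst zs \<in> rel X i \<longleftrightarrow> map snd zs \<in> rel Y i" if zs: "set zs \<subseteq> (\<Union>n. s n)" for zs i
  proof -
    obtain n where "set zs \<subseteq> s n" using fin[OF _ zs] by blast
    then show ?thesis using assms(1)[of n] by (simp add: piso_def)
  qed
  moreover have "(\<Union>n. s n) \<subseteq> verts X \<times> verts Y" using assms(1) unfolding piso_def by blast
  ultimately show ?thesis unfolding piso_def by blast
qed

text \<open>Countably many requirements are met one at a time. As \<open>R n\<close> is not assumed
  to be monotone, the conclusion retains the finite stage \<open>p'\<close> that satisfies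
  it.\<close>

lemma piso_generic_chain:
  assumes p0: "finite p0" "piso X Y p0"
    and step: "\<And>n p. finite p \<Longrightarrow> piso X Y p \<Longrightarrow> \<exists>p'. p \<subseteq> p' \<and> finite p' \<and> piso X Y p' \<and> R n p'"
  shows "\<exists>p. p0 \<subseteq> p \<and> piso X Y p \<and> (\<forall>n::nat. \<exists>p'\<subseteq>p. R n p')"
proof -
  obtain s where s: "s 0 = p0" "\<And>n. finite (s n) \<and> piso X Y (s n)"
      "\<And>n. s n \<subseteq> s (Suc n) \<and> R n (s (Suc n))"
  proof (rule that)
    define nxt where "nxt n p = (SOME p'. p \<subseteq> p' \<and> finite p' \<and> piso X Y p' \<and> R n p')" for n p
    define s where "s = rec_nat p0 nxt"
    have nxt: "p \<subseteq> nxt n p \<and> finite (nxt n p) \<and> piso X Y (nxt n p) \<and> R n (nxt n p)"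
      if "finite p" "piso X Y p" for n p
      unfolding nxt_def using step[OF that] by (rule someI_ex)
    show "s 0 = p0" by (simp add: s_def)
    show fin: "finite (s n) \<and> piso X Y (s n)" for n
      by (induction n) (use p0 nxt in \<open>simp_all add: s_def\<close>)
    show "s n \<subseteq> s (Suc n) \<and> R n (s (Suc n))" for n
      using nxt[of "s n" n] fin[of n] by (simp add: s_def)
  qed
  have "piso X Y (\<Union>n. s n)" using s by (intro piso_UN) auto
  moreover have "p0 \<subseteq> (\<Union>n. s n)" using s(1) by blast
  moreover have "\<exists>p'\<subseteq>(\<Union>n. s n). R n p'" for n using s(3)[of n] by blast
  ultimately show ?thesis by blast
qed

lemma embedding_by_extension:
  fixes X :: "nat rstruct"
  assumes "piso X Y {}"
    and ext: "\<And>p b. finite p \<Longrightarrow> piso X Y p \<Longrightarrow> b \<in> verts X \<Longrightarrow> \<exists>c. piso X Y (insert (b, c) p)"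
  shows "\<exists>f. is_embedding X Y f"
proof -
  have "\<exists>p'. p \<subseteq> p' \<and> finite p' \<and> piso X Y p' \<and> (n \<in> verts X \<longrightarrow> n \<in> Domain p')"
    if p: "finite p" "piso X Y p" for n p
  proof (cases "n \<in> verts X")
    case True
    then obtain c where "piso X Y (insert (n, c) p)" using ext[OF p] by blast
    then show ?thesis using p(1) by (intro exI[of _ "insert (n, c) p"]) auto
  qed (use p in auto)
  from piso_generic_chain[OF _ assms(1), of "\<lambda>n p'. n \<in> verts X \<longrightarrow> n \<in> Domain p'", OF _ this]
  obtain p where p: "piso X Y p" "\<forall>n. \<exists>p'\<subseteq>p. n \<in> verts X \<longrightarrow> n \<in> Domain p'"
    by auto
  have "Domain p = verts X"
  proof
    show "Domain p \<subseteq> verts X" using p(1) by (auto simp: piso_def)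
    show "verts X \<subseteq> Domain p" using p(2) by (meson Domain_mono subsetD subsetI)
  qed
  then show ?thesis using embedding_of_piso[OF p(1)] by blast
qed

text \<open>Source and target coincide, so the back step is the forth step applied to the converse.
  The vertices are natural numbers, and requirement \<open>n\<close> puts \<open>n\<close> into
  domain and range.\<close>

lemma ultrahomogeneous_by_extension:
  fixes X :: "nat rstruct"
  assumes ext: "\<And>p b. finite p \<Longrightarrow> piso X X p \<Longrightarrow> b \<in> verts X \<Longrightarrow> \<exists>c. piso X X (insert (b, c) p)"
  shows "ultrahomogeneous X"
  unfolding ultrahomogeneous_def
proof (intro allI impI, elim conjE)
  fix S T f
  assume S: "finite S" "S \<subseteq> verts X" "T \<subseteq> verts X" and f: "is_iso (induced X S) (induced X T) f"
  let ?p0 = "(\<lambda>x. (x, f x)) ` S"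
  have SX: "verts (induced X S) = S" "verts (induced X T) = T" using S by (auto simp: induced_def)
  have "piso (induced X S) (induced X T) ?p0"
    using piso_of_embedding[of "induced X S" "induced X T" f] f SX by (simp add: is_iso_def)
  then have p0: "piso X X ?p0"
  proof (rule piso_cong)
    have fS: "f ` S = T" using f SX by (simp add: is_iso_def)
    show "?p0 \<subseteq> verts X \<times> verts X" using S fS by auto
    show "xs \<in> rel (induced X S) i \<longleftrightarrow> xs \<in> rel X i" if "set xs \<subseteq> Domain ?p0" for i xs
      using that by (auto simp: induced_def)
    have "Range ?p0 = T" using fS by auto
    then show "xs \<in> rel (induced X T) i \<longleftrightarrow> xs \<in> rel X i" if "set xs \<subseteq> Range ?p0" for i xs
      using that by (auto simp: induced_def)
  qed
  have "\<exists>p'. p \<subseteq> p' \<and> finite p' \<and> piso X X p' \<and> (n \<in> verts X \<longrightarrow> n \<in> Domain p' \<and> n \<in> Range p')"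
    if p: "finite p" "piso X X p" for n p
  proof (cases "n \<in> verts X")
    case True
    then obtain c where c: "piso X X (insert (n, c) p)" using ext[OF p] by blast
    have "finite ((insert (n, c) p)\<inverse>)" using p(1) by simp
    then obtain d where "piso X X (insert (n, d) ((insert (n, c) p)\<inverse>))"
      using ext[OF _ piso_converse[OF c] True] by blast
    then have "piso X X ((insert (n, d) ((insert (n, c) p)\<inverse>))\<inverse>)" by (rule piso_converse)
    moreover have "(insert (n, d) ((insert (n, c) p)\<inverse>))\<inverse> = insert (d, n) (insert (n, c) p)" by auto
    ultimately show ?thesis
      using p(1) by (intro exI[of _ "insert (d, n) (insert (n, c) p)"]) auto
  qed (use p in auto)
  from piso_generic_chain[OF _ p0,
      of "\<lambda>n p'. n \<in> verts X \<longrightarrow> n \<in> Domain p' \<and> n \<in> Range p'", OF _ this] S(1)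
  obtain p where p: "?p0 \<subseteq> p" "piso X X p"
      "\<forall>n. \<exists>p'\<subseteq>p. n \<in> verts X \<longrightarrow> n \<in> Domain p' \<and> n \<in> Range p'"
    by auto
  have "x \<in> Domain p \<and> x \<in> Range p" if "x \<in> verts X" for x
    using p(3) that by (meson Domain_mono Range_mono subsetD)
  then have "verts X \<subseteq> Domain p" "verts X \<subseteq> Range p" by auto
  moreover have "p \<subseteq> verts X \<times> verts X" using p(2) by (simp add: piso_def)
  ultimately have dom: "Domain p = verts X" and ran: "Range p = verts X" by auto
  obtain g where g: "is_embedding X X g" "\<forall>x\<in>verts X. (x, g x) \<in> p"
    using embedding_of_piso[OF p(2) dom] .
  have g_eq: "g x = y" if "(x, y) \<in> p" for x y
  proof -
    have "(x, g x) \<in> p" using g(2) dom that by auto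
    then show ?thesis using p(2) that unfolding piso_def by (metis fst_conv snd_conv)
  qed
  have "verts X \<subseteq> g ` verts X"
  proof
    fix y assume "y \<in> verts X"
    then obtain x where "(x, y) \<in> p" using ran by auto
    then show "y \<in> g ` verts X" using g_eq dom by blast
  qed
  then have "is_iso X X g" using g(1) by (auto simp: is_iso_def is_embedding_def)
  moreover have "\<forall>x\<in>S. g x = f x" using g_eq p(1) by auto
  ultimately show "\<exists>g. is_iso X X g \<and> (\<forall>x\<in>S. g x = f x)" by blast
qed

subsection \<open>The canonical lift\<close>

text \<open>Covers induced substructures and isomorphic copies alike.\<close>

lemma Forb_h_hom:
  assumes "B \<in> Forb_h \<Delta> \<F>" "is_hom A B h" "structure_of \<Delta> A"
  shows "A \<in> Forb_h \<Delta> \<F>"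
  using assms hom_comp unfolding Forb_h_def by blast

lemma induced_structure_of: "structure_of \<Delta> A \<Longrightarrow> structure_of \<Delta> (induced A S)"
  by (auto simp: structure_of_def induced_def)

lemma hom_induced_id: "is_hom (induced A S) A (\<lambda>x. x)"
  by (auto simp: is_hom_def induced_def)

text \<open>Lists of vertices and of labelled tuples form a countable type; through it the finite
  structures, and with them all extension problems, can be enumerated.\<close>

definition decode :: "nat list \<times> (nat \<times> nat list) list \<Rightarrow> nat rstruct" where
  "decode c = \<lparr>verts = set (fst c), rel = (\<lambda>i. {xs. (i, xs) \<in> set (snd c)})\<rparr>"

lemma decode_surj:
  fixes A :: "nat rstruct"
  assumes "finite_type \<Delta>" "structure_of \<Delta> A" "finite (verts A)"
  shows "\<exists>c. decode c = A"
proof -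
  let ?T = "\<Union>i\<in>dom \<Delta>. Pair i ` {xs. set xs \<subseteq> verts A \<and> length xs = the (\<Delta> i)}"
  have "finite ?T"
    using assms(1,3) by (auto simp: finite_type_def intro!: finite_lists_length_eq)
  moreover have "{(i, xs). xs \<in> rel A i} \<subseteq> ?T"
  proof clarify
    fix i xs assume "xs \<in> rel A i"
    then have "\<Delta> i = Some (length xs)" "set xs \<subseteq> verts A"
      using assms(2) unfolding structure_of_def by blast+
    then show "(i, xs) \<in> ?T" by (intro UN_I[of i]) auto
  qed
  ultimately have "finite {(i, xs). xs \<in> rel A i}" using finite_subset by blast
  then obtain ts where ts: "set ts = {(i, xs). xs \<in> rel A i}" using finite_list by blast
  obtain vs where vs: "set vs = verts A" using finite_list[OF assms(3)] by blast
  have "decode (vs, ts) = A" using ts vs by (simp add: decode_def)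
  then show ?thesis ..
qed

text \<open>\<open>idx\<close> gives each piece a fresh symbol and \<open>roots\<close> lists its
  cut in a fixed order. Since the list is repetition-free, the arity of the symbol is the size of
  the cut.\<close>

locale piece_lift =
  fixes \<Delta> :: signature and \<F> :: "'v rstruct set"
    and idx :: "'v rstruct \<times> 'v set \<Rightarrow> nat" and roots :: "'v rstruct \<times> 'v set \<Rightarrow> 'v list"
  assumes type: "finite_type \<Delta>" and fin: "finite \<F>"
    and mem: "\<And>F. F \<in> \<F> \<Longrightarrow> structure_of \<Delta> F \<and> finite (verts F) \<and> connected_structure F"
    and idx_inj: "inj_on idx {(F, D). F \<in> \<F> \<and> is_piece F D}"
    and idx_new: "\<And>F D. F \<in> \<F> \<Longrightarrow> is_piece F D \<Longrightarrow> idx (F, D) \<notin> dom \<Delta>"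
    and roots: "\<And>F D. F \<in> \<F> \<Longrightarrow> is_piece F D \<Longrightarrow>
      set (roots (F, D)) = nbr (gaifman F) D \<and> distinct (roots (F, D))"
begin

definition pieces :: "('v rstruct \<times> 'v set) set" where
  "pieces = {(F, D). F \<in> \<F> \<and> is_piece F D}"

definition lift :: "'w rstruct \<Rightarrow> 'w rstruct" where
  "lift A = \<lparr>verts = verts A, rel = (\<lambda>i. if i \<in> dom \<Delta> then rel A i else
     {map f (roots (F, D)) | F D f. (F, D) \<in> pieces \<and> i = idx (F, D) \<and> is_hom (piece F D) A f})\<rparr>"

definition lift_type :: signature where
  "lift_type i = (if i \<in> dom \<Delta> then \<Delta> i
     else if i \<in> idx ` pieces then Some (length (roots (the_inv_into pieces idx i))) else None)"

lemma finite_pieces: "finite pieces"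
proof -
  have "pieces \<subseteq> (SIGMA F:\<F>. Pow (verts F))" by (auto simp: pieces_def is_piece_def)
  moreover have "finite (SIGMA F:\<F>. Pow (verts F))" using fin mem by blast
  ultimately show ?thesis by (rule finite_subset)
qed

lemma piecesD:
  assumes "(F, D) \<in> pieces"
  shows "F \<in> \<F>" "is_piece F D" "structure_of \<Delta> F" "finite (verts F)" "connected_structure F"
    "D \<subseteq> verts F" "idx (F, D) \<notin> dom \<Delta>" "set (roots (F, D)) = nbr (gaifman F) D"
    "distinct (roots (F, D))"
  using assms mem idx_new roots by (auto simp: pieces_def is_piece_def)

lemma verts_lift [simp]: "verts (lift A) = verts A"
  by (simp add: lift_def)

lemma rel_lift_old: "i \<in> dom \<Delta> \<Longrightarrow> rel (lift A) i = rel A i"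
  by (simp add: lift_def)

lemma rel_lift_idx:
  assumes "(F, D) \<in> pieces"
  shows "rel (lift A) (idx (F, D)) = {map f (roots (F, D)) | f. is_hom (piece F D) A f}"
proof -
  have "(F', D') = (F, D)" if "(F', D') \<in> pieces" "idx (F, D) = idx (F', D')" for F' D'
    by (rule inj_onD[OF idx_inj]) (use that assms in \<open>auto simp: pieces_def\<close>)
  then show ?thesis using assms piecesD(7)[OF assms] by (auto simp: lift_def)
qed

text \<open>The entries of \<open>roots (F, D)\<close> are all the cut vertices, so the tuple of
  images determines \<open>g\<close> on the cut, which is all that \<open>extends\<close>
  reads.\<close>

lemma map_mem_lift_iff:
  assumes "(F, D) \<in> pieces"
  shows "map g (roots (F, D)) \<in> rel (lift A) (idx (F, D)) \<longleftrightarrow> extends F D A g"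
  unfolding rel_lift_idx[OF assms] extends_def using piecesD(8)[OF assms]
  by (auto simp: map_eq_conv) metis+

lemma rel_liftE:
  assumes "xs \<in> rel (lift A) i"
  obtains "i \<in> dom \<Delta>" "xs \<in> rel A i"
  | F D f where "(F, D) \<in> pieces" "i = idx (F, D)" "is_hom (piece F D) A f" "xs = map f (roots (F, D))"
  using assms by (auto simp: lift_def split: if_splits)

section \<open>How the lift behaves under amalgams, homomorphisms and copies\<close>

lemma lift_agreeI:
  assumes old: "\<And>i xs. i \<in> dom \<Delta> \<Longrightarrow> set xs \<subseteq> W \<Longrightarrow> xs \<in> rel A i \<longleftrightarrow> xs \<in> rel B i"
    and new: "\<And>F D g. (F, D) \<in> pieces \<Longrightarrow> g ` nbr (gaifman F) D \<subseteq> W \<Longrightarrow>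
      extends F D A g \<longleftrightarrow> extends F D B g"
    and xs: "set xs \<subseteq> W"
  shows "xs \<in> rel (lift A) i \<longleftrightarrow> xs \<in> rel (lift B) i"
proof -
  have *: "xs \<in> rel (lift Y) i" if "xs \<in> rel (lift X) i"
    and XY: "\<And>i xs. i \<in> dom \<Delta> \<Longrightarrow> set xs \<subseteq> W \<Longrightarrow> xs \<in> rel X i \<Longrightarrow> xs \<in> rel Y i"
      "\<And>F D g. (F, D) \<in> pieces \<Longrightarrow> g ` nbr (gaifman F) D \<subseteq> W \<Longrightarrow>
        extends F D X g \<Longrightarrow> extends F D Y g" for X Y
    using that(1)
  proof (cases rule: rel_liftE)
    case 1
    then show ?thesis using XY(1)[of i] xs by (simp add: rel_lift_old)
  next
    case (2 F D f)
    have "f ` nbr (gaifman F) D \<subseteq> W" using xs 2 piecesD(8)[OF 2(1)] by auto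
    moreover have "extends F D X f" using 2 by (auto simp: extends_def)
    ultimately have "extends F D Y f" using XY(2) 2(1) by blast
    then show ?thesis using 2(2,4) by (simp add: map_mem_lift_iff[OF 2(1)])
  qed
  show ?thesis
  proof
    show "xs \<in> rel (lift B) i" if "xs \<in> rel (lift A) i"
      by (rule *[OF that]) (simp_all add: old new)
    show "xs \<in> rel (lift A) i" if "xs \<in> rel (lift B) i"
      by (rule *[OF that]) (simp_all add: old new)
  qed
qed

lemma compatible_liftI:
  assumes "structure_of \<Delta> X" "structure_of \<Delta> Y" "F \<in> \<F>"
    and agree: "\<And>i xs. set xs \<subseteq> verts X \<inter> verts Y \<Longrightarrow> xs \<in> rel (lift X) i \<longleftrightarrow> xs \<in> rel (lift Y) i"
  shows "compatible \<Delta> F X Y"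
  unfolding compatible_def
proof (intro conjI allI impI)
  fix i xs assume xs: "set xs \<subseteq> verts X \<inter> verts Y"
  show "xs \<in> rel X i \<longleftrightarrow> xs \<in> rel Y i"
  proof (cases "i \<in> dom \<Delta>")
    case True
    then show ?thesis using agree[OF xs, of i] by (simp add: rel_lift_old)
  next
    case False
    then show ?thesis using assms(1,2) unfolding structure_of_def by blast
  qed
next
  fix D g assume D: "is_piece F D" and g: "g ` nbr (gaifman F) D \<subseteq> verts X \<inter> verts Y"
  have FD: "(F, D) \<in> pieces" using D assms(3) by (simp add: pieces_def)
  have "set (map g (roots (F, D))) \<subseteq> verts X \<inter> verts Y" using g piecesD(8)[OF FD] by simp
  from agree[OF this, of "idx (F, D)"] show "extends F D X g \<longleftrightarrow> extends F D Y g"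
    by (simp add: map_mem_lift_iff[OF FD])
qed (fact assms)+

text \<open>The free amalgam of the shadows is thereby an amalgam of the lifts: no new relation
  acquires a tuple on the vertices of \<open>X\<close>.\<close>

lemma lift_glue:
  assumes XY: "\<And>F. F \<in> \<F> \<Longrightarrow> compatible \<Delta> F X Y" "structure_of \<Delta> Y"
    "\<And>i xs. set xs \<subseteq> verts X \<inter> verts Y \<Longrightarrow> xs \<in> rel (lift X) i \<longleftrightarrow> xs \<in> rel (lift Y) i"
    and xs: "set xs \<subseteq> verts X"
  shows "xs \<in> rel (lift (glue X Y)) i \<longleftrightarrow> xs \<in> rel (lift X) i"
proof (rule lift_agreeI[OF _ _ xs])
  fix i xs assume i: "i \<in> dom \<Delta>" "set xs \<subseteq> verts X"
  have "xs \<in> rel X i" if "xs \<in> rel Y i"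
  proof -
    have "set xs \<subseteq> verts X \<inter> verts Y" using that i(2) XY(2) unfolding structure_of_def by blast
    from XY(3)[OF this, of i] show ?thesis using that i(1) by (simp add: rel_lift_old)
  qed
  then show "xs \<in> rel (glue X Y) i \<longleftrightarrow> xs \<in> rel X i" by (auto simp: glue_def)
next
  fix F D g assume "(F, D) \<in> pieces" "g ` nbr (gaifman F) D \<subseteq> verts X"
  then show "extends F D (glue X Y) g \<longleftrightarrow> extends F D X g"
    using extends_glue_iff[OF _ _ XY(1)] piecesD[OF \<open>(F, D) \<in> pieces\<close>] by blast
qed

text \<open>A new relation asserts the existence of a homomorphism from a piece, hence is preserved
  by composition.\<close>

lemma lift_hom:
  assumes "is_hom A B h" "xs \<in> rel (lift A) i"
  shows "map h xs \<in> rel (lift B) i"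
  using assms(2)
proof (cases rule: rel_liftE)
  case 1
  then show ?thesis using assms(1) by (simp add: rel_lift_old is_hom_def)
next
  case (2 F D f)
  have "is_hom (piece F D) B (h \<circ> f)" using hom_comp 2(3) assms(1) by blast
  then have "map (h \<circ> f) (roots (F, D)) \<in> rel (lift B) i"
    unfolding 2(2) rel_lift_idx[OF 2(1)] by blast
  then show ?thesis using 2(4) by simp
qed

lemma lift_image_structure:
  assumes B: "structure_of \<Delta> B" "inj_on h (verts B)" "set xs \<subseteq> verts B"
  shows "map h xs \<in> rel (lift (image_structure h B)) i \<longleftrightarrow> xs \<in> rel (lift B) i"
proof
  assume "map h xs \<in> rel (lift (image_structure h B)) i"
  then have "map (inv_into (verts B) h) (map h xs) \<in> rel (lift B) i"
    by (rule lift_hom[OF hom_image_inv[OF B(1,2)]])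
  moreover have "map (inv_into (verts B) h) (map h xs) = xs"
    using B(2,3) by (auto intro!: map_idI)
  ultimately show "xs \<in> rel (lift B) i" by simp
qed (rule lift_hom[OF hom_image])

text \<open>Connectedness of \<open>F\<close> keeps the new symbols from being nullary.\<close>

lemma nbr_nonempty:
  assumes "(F, D) \<in> pieces"
  shows "nbr (gaifman F) D \<noteq> {}"
proof
  assume n: "nbr (gaifman F) D = {}"
  obtain E where E: "E \<subseteq> verts F" "lobes (gaifman F) D E" "D \<subseteq> verts F"
    using piecesD(2)[OF assms] by (auto simp: is_piece_def)
  then obtain x y where xy: "x \<in> D" "y \<in> E" by (auto simp: lobes_def linked_def)
  have "(x, y) \<in> (gaifman F)\<^sup>*"
    using piecesD(5)[OF assms] E xy by (auto simp: connected_structure_def)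
  then have "y \<in> D"
    by (induction rule: rtrancl_induct) (use n xy in \<open>auto simp: nbr_def\<close>)
  then show False using E xy by (auto simp: lobes_def)
qed

lemma lift_type_idx: "(F, D) \<in> pieces \<Longrightarrow> lift_type (idx (F, D)) = Some (length (roots (F, D)))"
  using idx_inj piecesD(7)[of F D]
  by (simp add: lift_type_def the_inv_into_f_f flip: pieces_def)

lemma finite_lift_type: "finite_type lift_type"
proof -
  have "dom lift_type \<subseteq> dom \<Delta> \<union> idx ` pieces" by (auto simp: lift_type_def split: if_splits)
  then have "finite (dom lift_type)"
    using type finite_pieces by (auto simp: finite_type_def intro: finite_subset)
  moreover have "lift_type i \<noteq> Some 0" for i
  proof (cases "i \<in> dom \<Delta>")
    case True
    then show ?thesis using type by (auto simp: lift_type_def finite_type_def ran_def)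
  next
    case False
    show ?thesis
    proof (cases "i \<in> idx ` pieces")
      case True
      then obtain F D where FD: "(F, D) \<in> pieces" "i = idx (F, D)" by auto
      have "roots (F, D) \<noteq> []" using nbr_nonempty[OF FD(1)] piecesD(8)[OF FD(1)] by auto
      then show ?thesis using lift_type_idx[OF FD(1)] FD(2) by simp
    qed (use False in \<open>simp add: lift_type_def\<close>)
  qed
  ultimately show ?thesis by (auto simp: finite_type_def ran_def)
qed

lemma structure_of_lift:
  assumes "structure_of \<Delta> A"
  shows "structure_of lift_type (lift A)"
  unfolding structure_of_def
proof (intro allI impI)
  fix i xs assume "xs \<in> rel (lift A) i"
  then show "lift_type i = Some (length xs) \<and> set xs \<subseteq> verts (lift A)"
  proof (cases rule: rel_liftE)
    case 1
    then show ?thesis using assms unfolding structure_of_def by (simp add: lift_type_def)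
  next
    case (2 F D f)
    have "f ` nbr (gaifman F) D \<subseteq> verts A"
      using 2(3)[unfolded piece_hom_iff[OF piecesD(3,6)[OF 2(1)]]] by blast
    then show ?thesis using 2(2,4) lift_type_idx[OF 2(1)] piecesD(8)[OF 2(1)] by simp
  qed
qed

lemma shadow_lift:
  assumes "structure_of \<Delta> A"
  shows "shadow \<Delta> (lift A) = A"
proof -
  have "rel A i = {}" if "i \<notin> dom \<Delta>" for i using assms that unfolding structure_of_def by blast
  then have "rel (shadow \<Delta> (lift A)) i = rel A i" for i
    by (cases "i \<in> dom \<Delta>") (simp_all add: shadow_def rel_lift_old)
  then have "rel (shadow \<Delta> (lift A)) = rel A" ..
  then show ?thesis by (simp add: shadow_def)
qed

text \<open>Restricting a structure may destroy new tuples on \<open>W\<close>, because the images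
  of the pieces behind them disappear. Only finitely many such tuples exist on the finite
  \<open>W\<close>, and adding the finite image of one piece for each preserves them.\<close>

lemma finite_witness:
  assumes B: "structure_of \<Delta> B" and W: "finite W" "W \<subseteq> verts B"
  obtains V where "finite V" "W \<subseteq> V" "V \<subseteq> verts B"
    "\<And>i xs. set xs \<subseteq> W \<Longrightarrow> xs \<in> rel (lift (induced B V)) i \<longleftrightarrow> xs \<in> rel (lift B) i"
proof -
  define T where "T = (SIGMA p:pieces. {xs. set xs \<subseteq> W \<and> length xs = length (roots p) \<and>
    xs \<in> rel (lift B) (idx p)})"
  have "finite {xs. set xs \<subseteq> W \<and> length xs = length (roots p) \<and> xs \<in> rel (lift B) (idx p)}" for p
    by (rule finite_subset[OF _ finite_lists_length_eq[OF W(1), of "length (roots p)"]]) auto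
  then have finT: "finite T" unfolding T_def using finite_pieces by blast
  have "\<exists>Z. finite Z \<and> Z \<subseteq> verts B \<and> (\<forall>V. Z \<subseteq> V \<longrightarrow> snd t \<in> rel (lift (induced B V)) (idx (fst t)))"
    if t: "t \<in> T" for t
  proof -
    obtain F D xs where t': "t = ((F, D), xs)" by (metis prod.collapse)
    then have FD: "(F, D) \<in> pieces" and "xs \<in> rel (lift B) (idx (F, D))" using t by (auto simp: T_def)
    then obtain f where f: "is_hom (piece F D) B f" "xs = map f (roots (F, D))"
      by (auto simp: rel_lift_idx)
    let ?P = "D \<union> nbr (gaifman F) D"
    note iff = piece_hom_iff[OF piecesD(3,6)[OF FD]]
    note f' = f(1)[unfolded iff]
    have "finite ?P"
      using piecesD(4,6)[OF FD] nbr_subset_verts[OF piecesD(3)[OF FD]] by (auto intro: finite_subset)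
    moreover have fP: "f ` ?P \<subseteq> verts B" using f' by blast
    moreover have "xs \<in> rel (lift (induced B V)) (idx (F, D))" if PV: "f ` ?P \<subseteq> V" for V
    proof -
      have "map f ys \<in> rel (induced B V) i" if "ys \<in> rel F i" "set ys \<subseteq> ?P" for ys i
      proof -
        have "set (map f ys) \<subseteq> V" using that(2) PV by auto
        moreover have "map f ys \<in> rel B i" using f' that by blast
        ultimately show ?thesis by (simp add: induced_def)
      qed
      moreover have "f ` ?P \<subseteq> verts (induced B V)"
        using PV fP by (simp add: induced_def)
      ultimately have "is_hom (piece F D) (induced B V) f" unfolding iff by blast
      then show ?thesis using f(2) by (auto simp: rel_lift_idx[OF FD])
    qed
    ultimately show ?thesis using t' by (intro exI[of _ "f ` ?P"]) auto
  qed
  then have "\<forall>t\<in>T. \<exists>Z. finite Z \<and> Z \<subseteq> verts B \<and>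
      (\<forall>V. Z \<subseteq> V \<longrightarrow> snd t \<in> rel (lift (induced B V)) (idx (fst t)))" by blast
  from bchoice[OF this] obtain Z where Z: "\<forall>t\<in>T. finite (Z t) \<and> Z t \<subseteq> verts B \<and>
      (\<forall>V. Z t \<subseteq> V \<longrightarrow> snd t \<in> rel (lift (induced B V)) (idx (fst t)))" by blast
  define V where "V = W \<union> (\<Union>t\<in>T. Z t)"
  have V: "finite V" "W \<subseteq> V" "V \<subseteq> verts B" using W Z finT by (auto simp: V_def)
  have "xs \<in> rel (lift (induced B V)) i \<longleftrightarrow> xs \<in> rel (lift B) i" if xs: "set xs \<subseteq> W" for i xs
  proof
    assume "xs \<in> rel (lift (induced B V)) i"
    then have "map (\<lambda>x. x) xs \<in> rel (lift B) i" by (rule lift_hom[OF hom_induced_id])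
    then show "xs \<in> rel (lift B) i" by simp
  next
    assume l: "xs \<in> rel (lift B) i"
    then show "xs \<in> rel (lift (induced B V)) i"
    proof (cases rule: rel_liftE)
      case 1
      then show ?thesis using xs V(2) by (auto simp: rel_lift_old induced_def)
    next
      case (2 F D f)
      then have t: "((F, D), xs) \<in> T" using l xs by (simp add: T_def)
      then have "Z ((F, D), xs) \<subseteq> V" by (auto simp: V_def)
      then show ?thesis using bspec[OF Z t] 2(2) by simp
    qed
  qed
  then show ?thesis by (rule that[OF V])
qed

subsection \<open>Construction of the generic structure\<close>

lemma amalgamation_step:
  fixes A B :: "nat rstruct"
  assumes A: "A \<in> Forb_h \<Delta> \<F>" "finite (verts A)" and B: "B \<in> Forb_h \<Delta> \<F>" "finite (verts B)"
    and p: "piso (lift B) (lift A) p"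
  shows "\<exists>A'. A' \<in> Forb_h \<Delta> \<F> \<and> finite (verts A') \<and> verts A \<subseteq> verts A' \<and>
    (\<forall>i xs. set xs \<subseteq> verts A \<longrightarrow> (xs \<in> rel (lift A') i \<longleftrightarrow> xs \<in> rel (lift A) i)) \<and>
    (\<exists>q. p \<subseteq> q \<and> piso (lift B) (lift A') q \<and> Domain q = verts B)"
proof -
  have sA: "structure_of \<Delta> A" and sB: "structure_of \<Delta> B" using A B by (auto simp: Forb_h_def)
  have pAB: "p \<subseteq> verts B \<times> verts A" using p by (simp add: piso_def)
  have p_eq: "a = c \<longleftrightarrow> b = d" if "(a, b) \<in> p" "(c, d) \<in> p" for a b c d
  proof -
    have "\<forall>u\<in>p. \<forall>v\<in>p. fst u = fst v \<longleftrightarrow> snd u = snd v" using p unfolding piso_def by blast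
    from bspec[OF bspec[OF this that(1)] that(2)] show ?thesis by simp
  qed
  obtain m where m: "\<forall>a\<in>verts A. a < m" using A(2) finite_nat_set_iff_bounded by blast
  \<comment> \<open>\<open>h\<close> copies \<open>B\<close> so that it meets \<open>A\<close> only
    along \<open>p\<close>: matched points go to their partners, and all others are shifted by the
    bound \<open>m\<close> past the vertices of \<open>A\<close>.\<close>
  define h where "h a = (if a \<in> Domain p then THE b. (a, b) \<in> p else m + a)" for a
  have hp: "h a = b" if "(a, b) \<in> p" for a b
  proof -
    have "(THE b. (a, b) \<in> p) = b" using that p_eq[OF that] by (intro the_equality) auto
    then show ?thesis using that by (auto simp: h_def)
  qed
  have h_new: "h a = m + a" if "a \<notin> Domain p" for a using that by (simp add: h_def)
  have h_old: "h a < m" if a: "a \<in> Domain p" for a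
  proof -
    obtain b where b: "(a, b) \<in> p" using a by auto
    then have "b \<in> verts A" using pAB by auto
    then show ?thesis using hp[OF b] m by simp
  qed
  have inj: "inj_on h (verts B)"
  proof (rule inj_onI)
    fix x y assume "h x = h y"
    show "x = y"
    proof (cases "x \<in> Domain p \<and> y \<in> Domain p")
      case True
      then obtain u v where "(x, u) \<in> p" "(y, v) \<in> p" by auto
      then show ?thesis using hp p_eq[of x u y v] \<open>h x = h y\<close> by simp
    next
      case False
      then show ?thesis
        using h_new[of x] h_new[of y] h_old[of x] h_old[of y] \<open>h x = h y\<close> by linarith
    qed
  qed
  let ?Y = "image_structure h B"
  have sY: "structure_of \<Delta> ?Y" using sB by (rule image_structure_of)
  have vY: "verts ?Y = h ` verts B" by (simp add: image_structure_def)
  have inter: "verts A \<inter> verts ?Y \<subseteq> Range p"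
  proof
    fix y assume y: "y \<in> verts A \<inter> verts ?Y"
    then obtain x where x: "x \<in> verts B" "y = h x" using vY by auto
    have "x \<in> Domain p"
    proof (rule ccontr)
      assume "x \<notin> Domain p"
      then show False using h_new[of x] x(2) y m by auto
    qed
    then show "y \<in> Range p" using hp x by auto
  qed
  have agree: "xs \<in> rel (lift A) i \<longleftrightarrow> xs \<in> rel (lift ?Y) i"
    if xs: "set xs \<subseteq> verts A \<inter> verts ?Y" for i xs
  proof -
    have "\<forall>y\<in>set xs. \<exists>x. (x, y) \<in> p" using xs inter by blast
    from bchoice[OF this] obtain k where k: "\<forall>y\<in>set xs. (k y, y) \<in> p" by blast
    define zs where "zs = map (\<lambda>y. (k y, y)) xs"
    have zs: "set zs \<subseteq> p" using k by (auto simp: zs_def)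
    have snd: "map snd zs = xs" by (simp add: zs_def comp_def)
    have hz: "map h (map fst zs) = map snd zs" using zs hp by auto
    have "set (map fst zs) \<subseteq> verts B" using zs pAB by auto
    from lift_image_structure[OF sB inj this]
    have "map fst zs \<in> rel (lift B) i \<longleftrightarrow> map snd zs \<in> rel (lift ?Y) i" unfolding hz by blast
    moreover have "map fst zs \<in> rel (lift B) i \<longleftrightarrow> map snd zs \<in> rel (lift A) i"
      using p zs unfolding piso_def by blast
    ultimately show ?thesis unfolding snd by blast
  qed
  have comp: "compatible \<Delta> F A ?Y" if "F \<in> \<F>" for F
    by (rule compatible_liftI[OF sA sY that agree])
  have YF: "?Y \<in> Forb_h \<Delta> \<F>"
    by (rule Forb_h_hom[OF B(1) hom_image_inv[OF sB inj] sY])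
  let ?A' = "glue A ?Y"
  have "structure_of \<Delta> ?A'"
    using sA sY unfolding structure_of_def glue_def by (simp, blast)
  moreover have "\<not> is_hom F ?A' f" if F: "F \<in> \<F>" for F f
  proof
    assume "is_hom F ?A' f"
    then have "\<exists>f'. is_hom F A f' \<or> is_hom F ?Y f'"
      using hom_glue[OF _ _ _ comp[OF F]] mem[OF F] by blast
    then show False using A(1) YF F by (auto simp: Forb_h_def)
  qed
  ultimately have "?A' \<in> Forb_h \<Delta> \<F>" by (auto simp: Forb_h_def)
  moreover have "finite (verts ?A')" using A(2) B(2) by (simp add: glue_def vY)
  moreover have "verts A \<subseteq> verts ?A'" by (simp add: glue_def)
  moreover have lA: "xs \<in> rel (lift ?A') i \<longleftrightarrow> xs \<in> rel (lift A) i" if "set xs \<subseteq> verts A" for xs i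
    by (rule lift_glue[OF comp sY agree that])
  moreover have "\<exists>q. p \<subseteq> q \<and> piso (lift B) (lift ?A') q \<and> Domain q = verts B"
  proof (intro exI conjI)
    let ?q = "(\<lambda>x. (x, h x)) ` verts B"
    show "p \<subseteq> ?q"
    proof
      fix z assume z: "z \<in> p"
      then have "z = (fst z, h (fst z))" "fst z \<in> verts B" using hp[of "fst z" "snd z"] pAB by auto
      then show "z \<in> ?q" by blast
    qed
    show "Domain ?q = verts B" by auto
    have lY: "xs \<in> rel (lift ?A') i \<longleftrightarrow> xs \<in> rel (lift ?Y) i" if "set xs \<subseteq> verts ?Y" for xs i
      unfolding glue_commute[of A]
      by (rule lift_glue[OF compatible_sym[OF comp] sA _ that]) (use agree in auto)
    have "is_embedding (lift B) (lift ?A') h"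
      unfolding is_embedding_def
    proof (intro conjI allI impI)
      show "h ` verts (lift B) \<subseteq> verts (lift ?A')" by (simp add: glue_def vY)
      fix i xs assume xs: "set xs \<subseteq> verts (lift B)"
      then have "set (map h xs) \<subseteq> verts ?Y" using vY by auto
      from lY[OF this, of i] lift_image_structure[OF sB inj, of xs i] xs
      show "xs \<in> rel (lift B) i \<longleftrightarrow> map h xs \<in> rel (lift ?A') i" by simp
    qed (use inj in simp)
    from piso_of_embedding[OF this] show "piso (lift B) (lift ?A') ?q" by simp
  qed
  ultimately show ?thesis by blast
qed

text \<open>Step \<open>n\<close> of the construction handles the extension problem coded by \<open>n\<close>; the first component
  of the code is a dummy that lets every problem recur infinitely often.\<close>

definition task :: "nat \<Rightarrow> nat rstruct \<times> (nat \<times> nat) set" where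
  "task n = (let (_ :: nat, c, l) = from_nat n in (decode c, set l))"

lemma task_recurs:
  assumes B: "structure_of \<Delta> B" "finite (verts B)" and p: "finite p"
  shows "\<exists>n\<ge>m. task n = (B, p)"
proof -
  obtain c where c: "decode c = B" using decode_surj[OF type B] by blast
  obtain l where l: "set l = p" using finite_list[OF p] by blast
  define g where "g k = to_nat (k :: nat, c, l)" for k
  have "inj g" unfolding g_def by (intro injI) (simp add: inj_eq[OF inj_to_nat])
  then have "infinite (range g)" by (simp add: finite_image_iff)
  then obtain k where "g k \<ge> m" by (metis finite_nat_set_iff_bounded imageE not_le)
  moreover have "task (g k) = (B, p)" by (simp add: task_def g_def c l)
  ultimately show ?thesis by blast
qed

text \<open>Preserving the lift on old vertices, and not just the shadow, keeps solved problems
  solved. If the code does not describe an extension problem over \<open>A\<close>, nothing is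
  demanded beyond this.\<close>

definition chain_step :: "nat \<Rightarrow> nat rstruct \<Rightarrow> nat rstruct \<Rightarrow> bool" where
  "chain_step n A A' \<longleftrightarrow> A' \<in> Forb_h \<Delta> \<F> \<and> finite (verts A') \<and> verts A \<subseteq> verts A' \<and>
    (\<forall>i xs. set xs \<subseteq> verts A \<longrightarrow> (xs \<in> rel (lift A') i \<longleftrightarrow> xs \<in> rel (lift A) i)) \<and>
    (\<forall>B p. task n = (B, p) \<longrightarrow> B \<in> Forb_h \<Delta> \<F> \<longrightarrow> finite (verts B) \<longrightarrow> piso (lift B) (lift A) p \<longrightarrow>
      (\<exists>q. p \<subseteq> q \<and> piso (lift B) (lift A') q \<and> Domain q = verts B))"

lemma chain_step_exists:
  assumes A: "A \<in> Forb_h \<Delta> \<F>" "finite (verts A)"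
  shows "\<exists>A'. chain_step n A A'"
proof -
  obtain B p where t: "task n = (B, p)" by fastforce
  show ?thesis
  proof (cases "B \<in> Forb_h \<Delta> \<F> \<and> finite (verts B) \<and> piso (lift B) (lift A) p")
    case True
    then show ?thesis
      using amalgamation_step[OF A, of B p] t unfolding chain_step_def by auto
  next
    case False
    then have "chain_step n A A" using A t unfolding chain_step_def by auto
    then show ?thesis ..
  qed
qed

lemma chain_exists:
  obtains S where "\<And>n. S n \<in> Forb_h \<Delta> \<F> \<and> finite (verts (S n))" "\<And>n. chain_step n (S n) (S (Suc n))"
proof -
  \<comment> \<open>The empty structure avoids all of the family, because connected structures are
    nonempty.\<close>
  let ?E = "\<lparr>verts = {}, rel = \<lambda>_. {}\<rparr> :: nat rstruct"
  have E: "?E \<in> Forb_h \<Delta> \<F> \<and> finite (verts ?E)"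
    using mem by (auto simp: Forb_h_def structure_of_def is_hom_def connected_structure_def)
  define S where "S = rec_nat ?E (\<lambda>n A. SOME A'. chain_step n A A')"
  have step: "chain_step n (S n) (S (Suc n))" if "S n \<in> Forb_h \<Delta> \<F> \<and> finite (verts (S n))" for n
    using someI_ex[OF chain_step_exists, of "S n" n] that by (simp add: S_def)
  have S: "S n \<in> Forb_h \<Delta> \<F> \<and> finite (verts (S n))" for n
  proof (induction n)
    case 0
    then show ?case using E by (simp add: S_def)
  next
    case (Suc n)
    then show ?case using step[OF Suc] unfolding chain_step_def by blast
  qed
  show ?thesis using that[of S] S step by blast
qed

text \<open>The limit is the union of the chain. A one-point extension problem over a possibly
  infinite \<open>B\<close> concerns a finite set only, and \<open>finite_witness\<close> turns it
  into a finite problem that occurs in the enumeration.\<close>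

lemma generic_exists:
  obtains U where "U \<in> Forb_h \<Delta> \<F>"
    "\<And>B p b. B \<in> Forb_h \<Delta> \<F> \<Longrightarrow> finite p \<Longrightarrow> piso (lift B) (lift U) p \<Longrightarrow> b \<in> verts B \<Longrightarrow>
      \<exists>c. piso (lift B) (lift U) (insert (b, c) p)"
proof -
  obtain S where S: "\<And>n. S n \<in> Forb_h \<Delta> \<F> \<and> finite (verts (S n))"
    and step: "\<And>n. chain_step n (S n) (S (Suc n))" using chain_exists by blast
  have sS: "structure_of \<Delta> (S n)" for n using S[of n] by (simp add: Forb_h_def)
  have mono: "verts (S m) \<subseteq> verts (S n)" if "m \<le> n" for m n
    using lift_Suc_mono_le[of "\<lambda>n. verts (S n)", OF _ that] step unfolding chain_step_def by blast
  have agree: "xs \<in> rel (lift (S n)) i \<longleftrightarrow> xs \<in> rel (lift (S m)) i"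
    if "m \<le> n" "set xs \<subseteq> verts (S m)" for m n xs i
    using that
  proof (induction n rule: dec_induct)
    case (step n)
    then have "set xs \<subseteq> verts (S n)" using mono by blast
    then show ?case using step \<open>\<And>n. chain_step n (S n) (S (Suc n))\<close> unfolding chain_step_def by blast
  qed simp
  define U where "U = \<lparr>verts = \<Union>n. verts (S n), rel = \<lambda>i. \<Union>n. rel (S n) i\<rparr>"
  have vU: "verts U = (\<Union>n. verts (S n))" by (simp add: U_def)
  have sU: "structure_of \<Delta> U"
    using sS unfolding structure_of_def U_def by (simp, blast)
  have old: "xs \<in> rel U i \<longleftrightarrow> xs \<in> rel (S n) i" if i: "i \<in> dom \<Delta>" and xs: "set xs \<subseteq> verts (S n)" for i xs n
  proof
    assume "xs \<in> rel U i"
    then obtain m where m: "xs \<in> rel (S m) i" by (auto simp: U_def)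
    then have xm: "set xs \<subseteq> verts (S m)" using sS[of m] unfolding structure_of_def by blast
    have "xs \<in> rel (lift (S m)) i" using m i by (simp add: rel_lift_old)
    then have "xs \<in> rel (lift (S n)) i"
      using agree[of m n xs i] agree[of n m xs i] xs xm by (cases "m \<le> n") auto
    then show "xs \<in> rel (S n) i" using i by (simp add: rel_lift_old)
  qed (auto simp: U_def)
  have incl: "is_hom (S n) U (\<lambda>x. x)" for n by (auto simp: is_hom_def U_def)
  have capture: "\<exists>n. Z \<subseteq> verts (S n)" if "finite Z" "Z \<subseteq> verts U" for Z
    using that
  proof (induction Z)
    case (insert z Z)
    then obtain m n where "Z \<subseteq> verts (S m)" "z \<in> verts (S n)" by (auto simp: vU)
    then have "insert z Z \<subseteq> verts (S (max m n))"
      using mono[of m "max m n"] mono[of n "max m n"] by auto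
    then show ?case by blast
  qed simp
  have descend: "is_hom P (S n) f"
    if P: "structure_of \<Delta> P" and f: "is_hom P U f" "f ` verts P \<subseteq> verts (S n)"
    for P :: "'v rstruct" and f n
  proof -
    have "map f xs \<in> rel (S n) i" if xs: "xs \<in> rel P i" for xs i
    proof -
      have "i \<in> dom \<Delta>" "set xs \<subseteq> verts P" using P xs unfolding structure_of_def by auto
      moreover have "map f xs \<in> rel U i" using f(1) xs by (simp add: is_hom_def)
      ultimately show ?thesis using old[of i "map f xs" n] f(2) by auto
    qed
    then show ?thesis using f(2) by (simp add: is_hom_def)
  qed
  have UF: "U \<in> Forb_h \<Delta> \<F>"
  proof -
    have "\<not> is_hom F U f" if F: "F \<in> \<F>" for F f
    proof
      assume f: "is_hom F U f"
      then obtain n where "f ` verts F \<subseteq> verts (S n)"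
        using capture[of "f ` verts F"] mem[OF F] by (auto simp: is_hom_def)
      then have "is_hom F (S n) f" using descend f mem[OF F] by blast
      then show False using S[of n] F by (auto simp: Forb_h_def)
    qed
    then show ?thesis using sU by (auto simp: Forb_h_def)
  qed
  \<comment> \<open>Pieces are finite, so a homomorphism from a piece into \<open>U\<close> already
    lands in some stage.\<close>
  have lU: "xs \<in> rel (lift U) i \<longleftrightarrow> xs \<in> rel (lift (S n)) i" if xs: "set xs \<subseteq> verts (S n)" for xs i n
  proof
    assume "xs \<in> rel (lift (S n)) i"
    from lift_hom[OF incl this] show "xs \<in> rel (lift U) i" by simp
  next
    assume "xs \<in> rel (lift U) i"
    then show "xs \<in> rel (lift (S n)) i"
    proof (cases rule: rel_liftE)
      case 1
      then show ?thesis using old[OF _ xs] by (simp add: rel_lift_old)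
    next
      case (2 F D f)
      let ?P = "piece F D"
      have fU: "f ` verts ?P \<subseteq> verts U" using 2(3) by (simp add: is_hom_def)
      have "finite (verts ?P)" using piecesD(4)[OF 2(1)] by (simp add: piece_def induced_def)
      then obtain m where m: "f ` verts ?P \<subseteq> verts (S m)" using capture[OF _ fU] by auto
      then have m': "f ` verts ?P \<subseteq> verts (S (max m n))" using mono[of m "max m n"] by auto
      have "structure_of \<Delta> ?P" unfolding piece_def
        by (rule induced_structure_of[OF piecesD(3)[OF 2(1)]])
      from descend[OF this 2(3) m'] have "xs \<in> rel (lift (S (max m n))) i"
        unfolding 2(2,4) rel_lift_idx[OF 2(1)] by blast
      then show ?thesis using agree[of n "max m n"] xs by simp
    qed
  qed
  have "\<exists>c. piso (lift B) (lift U) (insert (b, c) p)"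
    if B: "B \<in> Forb_h \<Delta> \<F>" and p: "finite p" "piso (lift B) (lift U) p" and b: "b \<in> verts B" for B p b
  proof -
    have sB: "structure_of \<Delta> B" using B by (simp add: Forb_h_def)
    have pBU: "p \<subseteq> verts B \<times> verts U" using p(2) by (simp add: piso_def)
    define W where "W = insert b (Domain p)"
    have W: "finite W" "W \<subseteq> verts B" using p(1) pBU b by (auto simp: W_def finite_Domain)
    obtain V where V: "finite V" "W \<subseteq> V" "V \<subseteq> verts B"
      "\<And>i xs. set xs \<subseteq> W \<Longrightarrow> xs \<in> rel (lift (induced B V)) i \<longleftrightarrow> xs \<in> rel (lift B) i"
      using finite_witness[OF sB W] by blast
    let ?B = "induced B V"
    have vB: "verts ?B = V" using V(3) by (auto simp: induced_def)
    have sB': "structure_of \<Delta> ?B" by (rule induced_structure_of[OF sB])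
    have BF: "?B \<in> Forb_h \<Delta> \<F>" by (rule Forb_h_hom[OF B hom_induced_id sB'])
    have "Range p \<subseteq> verts U" "finite (Range p)" using pBU p(1) by (auto simp: finite_Range)
    then obtain m where m: "Range p \<subseteq> verts (S m)" using capture by blast
    \<comment> \<open>Recurrence of tasks matters here: the problem has to come up after stage
      \<open>m\<close>, when the range of \<open>p\<close> is present.\<close>
    obtain n where n: "n \<ge> m" "task n = (?B, p)"
      using task_recurs[OF sB' _ p(1)] V(1) vB by auto
    have Rn: "Range p \<subseteq> verts (S n)" using m mono[OF n(1)] by blast
    have iso: "piso (lift ?B) (lift (S n)) p"
    proof (rule piso_cong[OF p(2)])
      have "Domain p \<subseteq> V" using V(2) by (auto simp: W_def)
      then show "p \<subseteq> verts (lift ?B) \<times> verts (lift (S n))" using Rn vB by auto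
      show "xs \<in> rel (lift B) i \<longleftrightarrow> xs \<in> rel (lift ?B) i" if "set xs \<subseteq> Domain p" for i xs
        using V(4)[of xs i] that by (auto simp: W_def)
      show "xs \<in> rel (lift U) i \<longleftrightarrow> xs \<in> rel (lift (S n)) i" if "set xs \<subseteq> Range p" for i xs
        using lU[of xs n i] that Rn by blast
    qed
    have "finite (verts ?B)" using V(1) vB by simp
    then obtain q where "p \<subseteq> q" "piso (lift ?B) (lift (S (Suc n))) q" "Domain q = verts ?B"
      using step[of n] n(2) BF iso unfolding chain_step_def by blast
    then have q: "p \<subseteq> q" "piso (lift ?B) (lift (S (Suc n))) q" "Domain q = V" by (simp_all add: vB)
    have "b \<in> Domain q" using q(3) V(2) by (auto simp: W_def)
    then obtain c where c: "(b, c) \<in> q" by auto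
    have qS: "q \<subseteq> V \<times> verts (S (Suc n))" using q(2) vB by (simp add: piso_def)
    have "piso (lift ?B) (lift (S (Suc n))) (insert (b, c) p)"
      using q c by (intro piso_subset[OF q(2)]) auto
    then have "piso (lift B) (lift U) (insert (b, c) p)"
    proof (rule piso_cong)
      show "insert (b, c) p \<subseteq> verts (lift B) \<times> verts (lift U)"
        using pBU b c qS by (auto simp: vU)
      show "xs \<in> rel (lift ?B) i \<longleftrightarrow> xs \<in> rel (lift B) i" if "set xs \<subseteq> Domain (insert (b, c) p)" for i xs
        using V(4)[of xs i] that by (auto simp: W_def)
      have "Range (insert (b, c) p) \<subseteq> verts (S (Suc n))" using q(1) c qS by auto
      then show "xs \<in> rel (lift (S (Suc n))) i \<longleftrightarrow> xs \<in> rel (lift U) i"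
        if "set xs \<subseteq> Range (insert (b, c) p)" for i xs
        using lU[of xs "Suc n" i] that by blast
    qed
    then show ?thesis ..
  qed
  then show ?thesis using that UF by blast
qed

text \<open>One extension property serves twice: with \<open>U\<close> itself as source it gives
  ultrahomogeneity, and with an arbitrary source universality.\<close>

lemma lift_class_generic:
  obtains U where "generic_for (lift ` Forb_h \<Delta> \<F>) U"
proof -
  obtain U where U: "U \<in> Forb_h \<Delta> \<F>"
    "\<And>B p b. B \<in> Forb_h \<Delta> \<F> \<Longrightarrow> finite p \<Longrightarrow> piso (lift B) (lift U) p \<Longrightarrow> b \<in> verts B \<Longrightarrow>
      \<exists>c. piso (lift B) (lift U) (insert (b, c) p)" using generic_exists by blast
  have "ultrahomogeneous (lift U)"
    by (rule ultrahomogeneous_by_extension) (use U in auto)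
  moreover have "\<exists>f. is_embedding A (lift U) f" if A: "A \<in> lift ` Forb_h \<Delta> \<F>" for A
  proof -
    obtain B where B: "B \<in> Forb_h \<Delta> \<F>" "A = lift B" using A by auto
    \<comment> \<open>Positive arities make the empty map a partial isomorphism, from which the
      embedding is built.\<close>
    have "[] \<notin> rel (lift C) i" if "C \<in> Forb_h \<Delta> \<F>" for C i
    proof
      assume "[] \<in> rel (lift C) i"
      then have "lift_type i = Some 0"
        using structure_of_lift[of C] that unfolding structure_of_def Forb_h_def by fastforce
      then show False using finite_lift_type unfolding finite_type_def ran_def by blast
    qed
    then have "piso (lift B) (lift U) {}" using B U(1) by (simp add: piso_def)
    then show ?thesis
      unfolding B(2) by (rule embedding_by_extension) (use U(2)[OF B(1)] in auto)
  qed
  ultimately have "generic_for (lift ` Forb_h \<Delta> \<F>) (lift U)"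
    using U(1) unfolding generic_for_def by blast
  then show ?thesis by (rule that)
qed

end

subsection \<open>Necessity of small cuts\<close>

text \<open>Counting: there are \<open>2 ^ N ^ card C\<close> two-colourings of the transversals, but only
  \<open>2 ^ O(N ^ r)\<close> systems \<open>L\<close> of relations of arity at most \<open>r\<close> on \<open>C \<times> {..<N}\<close>.\<close>

lemma colouring_not_determined:
  fixes C :: "'v set" and I :: "nat set"
  assumes fin: "finite C" "finite I" and r: "r < card C"
  shows "\<exists>N \<chi>. \<forall>L. \<exists>f\<in>C \<rightarrow>\<^sub>E {..<N}. \<exists>g\<in>C \<rightarrow>\<^sub>E {..<N}. \<chi> f \<and> \<not> \<chi> g \<and>
    (\<forall>i\<in>I. \<forall>ys. set ys \<subseteq> C \<longrightarrow> length ys \<le> r \<longrightarrow>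
      ((i, map (\<lambda>c. (c, f c :: nat)) ys) \<in> L \<longleftrightarrow> (i, map (\<lambda>c. (c, g c)) ys) \<in> L))"
proof -
  define k where "k = card C"
  define CL where "CL = I \<times> {ys. set ys \<subseteq> C \<and> length ys \<le> r}"
  \<comment> \<open>With \<open>k = card C\<close>, the set \<open>BL\<close> has at most
    \<open>card I * (r + 1) * k ^ r * N ^ r\<close> elements, against
    \<open>N ^ k \<ge> N ^ (r + 1)\<close> transversals. \<open>N\<close> exceeds the coefficient of
    \<open>N ^ r\<close> together with the number \<open>2 ^ card CL\<close> of possible
    types.\<close>
  define N where "N = card I * ((r + 1) * k ^ r) + 2 ^ card CL + 1"
  define BL where "BL = I \<times> {zs. set zs \<subseteq> C \<times> {..<N} \<and> length zs \<le> r}"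
  define Tr where "Tr = C \<rightarrow>\<^sub>E {..<N}"
  define ty where "ty L f = {(i, ys) \<in> CL. (i, map (\<lambda>c. (c, f c)) ys) \<in> L}"
    for L :: "(nat \<times> ('v \<times> nat) list) set" and f
  have finCL: "finite CL" using fin by (simp add: CL_def finite_lists_length_le)
  have finBL: "finite BL" using fin by (simp add: BL_def finite_lists_length_le)
  have finTr: "finite Tr" using fin by (simp add: Tr_def finite_PiE)
  have "k > 0" "N > 0" using r by (auto simp: k_def N_def)
  have cardTr: "card Tr = N ^ k" using fin by (simp add: Tr_def card_PiE k_def)
  have "card BL = card I * (\<Sum>j\<le>r. (k * N) ^ j)"
    using fin by (simp add: BL_def card_cartesian_product card_lists_length_le k_def)
  also have "(\<Sum>j\<le>r. (k * N) ^ j) \<le> (\<Sum>j\<le>r. (k * N) ^ r)"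
    using \<open>k > 0\<close> \<open>N > 0\<close> by (intro sum_mono power_increasing) auto
  finally have "card BL \<le> card I * ((r + 1) * (k * N) ^ r)" by simp
  also have "\<dots> = card I * ((r + 1) * k ^ r) * N ^ r" 
    unfolding power_mult_distrib by (simp only: mult.assoc)
  finally have "card BL + 2 ^ card CL \<le> card I * ((r + 1) * k ^ r) * N ^ r + 2 ^ card CL * N ^ r"
    using \<open>N > 0\<close> by (intro add_mono) auto
  also have "\<dots> < N * N ^ r" using \<open>N > 0\<close> by (simp add: N_def algebra_simps)
  also have "\<dots> \<le> N ^ k"
    using power_increasing[of "Suc r" k N] r \<open>N > 0\<close> by (simp add: k_def)
  finally have less: "card BL + 2 ^ card CL < card Tr" by (simp add: cardTr)
  \<comment> \<open>A colouring determined by \<open>L\<close> is recovered from \<open>L\<close>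
    and the set \<open>h\<close> of types with the first colour; there are too few such
    pairs.\<close>
  define \<Psi> where "\<Psi> = (\<lambda>(L, h). {f \<in> Tr. ty L f \<in> h})"
  have "\<not> Pow Tr \<subseteq> \<Psi> ` (Pow BL \<times> Pow (Pow CL))"
  proof
    assume "Pow Tr \<subseteq> \<Psi> ` (Pow BL \<times> Pow (Pow CL))"
    then have "card (Pow Tr) \<le> card (Pow BL \<times> Pow (Pow CL))"
      using finBL finCL by (intro surj_card_le) auto
    also have "\<dots> = 2 ^ (card BL + 2 ^ card CL)"
      using finBL finCL by (simp add: card_cartesian_product card_Pow power_add)
    finally show False using less finTr by (simp add: card_Pow)
  qed
  then obtain X where X: "X \<subseteq> Tr" "X \<notin> \<Psi> ` (Pow BL \<times> Pow (Pow CL))" by blast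
  have confused: "\<exists>f\<in>Tr. \<exists>g\<in>Tr. f \<in> X \<and> g \<notin> X \<and> ty L f = ty L g" for L
  proof (rule ccontr)
    assume no: "\<not> ?thesis"
    \<comment> \<open>\<open>L\<close> is arbitrary and perhaps infinite, but types read only its
      part in the finite set \<open>BL\<close>.\<close>
    have "ty (L \<inter> BL) f = ty L f" if "f \<in> Tr" for f
      using that by (fastforce simp: ty_def BL_def CL_def Tr_def PiE_iff)
    moreover have "x \<in> X" if "x \<in> Tr" "y \<in> X" "ty L x = ty L y" for x y
      using no X(1) that by (metis subsetD)
    ultimately have "X = \<Psi> (L \<inter> BL, ty L ` X)" using X(1) by (auto simp: \<Psi>_def)
    moreover have "(L \<inter> BL, ty L ` X) \<in> Pow BL \<times> Pow (Pow CL)" by (auto simp: ty_def)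
    ultimately show False using X(2) by (metis imageI)
  qed
  have same: "(i, map (\<lambda>c. (c, f c)) ys) \<in> L \<longleftrightarrow> (i, map (\<lambda>c. (c, g c)) ys) \<in> L"
    if "ty L f = ty L g" "i \<in> I" "set ys \<subseteq> C" "length ys \<le> r" for L f g i ys
  proof -
    have "(i, ys) \<in> ty L f \<longleftrightarrow> (i, ys) \<in> ty L g" using that by simp
    then show ?thesis using that by (simp add: ty_def CL_def)
  qed
  have "\<exists>f\<in>Tr. \<exists>g\<in>Tr. f \<in> X \<and> g \<notin> X \<and> (\<forall>i\<in>I. \<forall>ys. set ys \<subseteq> C \<longrightarrow> length ys \<le> r \<longrightarrow>
      ((i, map (\<lambda>c. (c, f c)) ys) \<in> L \<longleftrightarrow> (i, map (\<lambda>c. (c, g c)) ys) \<in> L))" for L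
  proof -
    obtain f g where fg: "f \<in> Tr" "g \<in> Tr" "f \<in> X" "g \<notin> X" "ty L f = ty L g"
      using confused by blast
    show ?thesis
      by (rule bexI[OF _ fg(1)], rule bexI[OF _ fg(2)]) (use fg(3,4) same[OF fg(5)] in simp)
  qed
  then show ?thesis unfolding Tr_def by (intro exI[of _ N] exI[of _ "\<lambda>f. f \<in> X"]) simp
qed

section \<open>The two-coloured blow-up of a cut\<close>

locale cut_amalgam =
  fixes \<Delta> :: signature and F :: "'v rstruct" and D E C :: "'v set" and N :: nat
    and \<chi> :: "('v \<Rightarrow> nat) \<Rightarrow> bool"
  assumes F: "structure_of \<Delta> F" "finite (verts F)"
    and lobes: "lobes (gaifman F) D E" "D \<subseteq> verts F" "E \<subseteq> verts F" "nbr (gaifman F) D = C"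
begin

definition Tr :: "('v \<Rightarrow> nat) set" where
  "Tr = C \<rightarrow>\<^sub>E {..<N}"

text \<open>The second part is everything outside \<open>D\<close>, not just \<open>E\<close> with
  the cut; so every tuple of \<open>F\<close> lies in one of the two parts.\<close>

definition part :: "bool \<Rightarrow> 'v set" where
  "part b = (if b then D \<union> C else verts F - D)"

definition copy :: "('v \<Rightarrow> nat) \<Rightarrow> 'v \<Rightarrow> 'v \<times> ('v \<Rightarrow> nat)" where
  "copy f v = (v, if v \<in> C then (\<lambda>_. f v) else f)"

text \<open>The copies of the two sides of the cut share exactly the vertices over \<open>C\<close>, on which
  \<^const>\<open>copy\<close> forgets all but one value of the transversal.\<close>

definition amalgam :: "('v \<times> ('v \<Rightarrow> nat)) rstruct" where
  "amalgam = \<lparr>verts = (\<Union>f\<in>Tr. copy f ` part (\<chi> f)),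
     rel = (\<lambda>i. \<Union>f\<in>Tr. map (copy f) ` {xs \<in> rel F i. set xs \<subseteq> part (\<chi> f)})\<rparr>"

lemma fst_copy [simp]: "fst (copy f v) = v"
  by (simp add: copy_def)

lemma C_verts: "C \<subseteq> verts F"
  using nbr_subset_verts[OF F(1), of D] lobes(4) by simp

lemma CD: "C \<inter> D = {}" and CE: "C \<inter> E = {}" and DE: "D \<inter> E = {}" and nbrE: "nbr (gaifman F) E = C"
  and linkedD: "linked (gaifman F) D" and linkedE: "linked (gaifman F) E"
proof -
  show "linked (gaifman F) D" "linked (gaifman F) E" "D \<inter> E = {}" "nbr (gaifman F) E = C"
    using lobes by (auto simp: lobes_def)
  then show "C \<inter> D = {}" "C \<inter> E = {}"
    using nbr_disjoint[of D "gaifman F"] nbr_disjoint[of E "gaifman F"] lobes(4) by auto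
qed

lemma C_part: "C \<subseteq> part b"
  using CD C_verts by (auto simp: part_def)

lemma part_verts: "part b \<subseteq> verts F"
  using C_verts lobes(2) by (auto simp: part_def)

lemma finite_amalgam: "finite (verts amalgam)"
proof -
  have "finite Tr" unfolding Tr_def using C_verts F(2) by (auto intro!: finite_PiE intro: finite_subset)
  then show ?thesis using part_verts F(2) by (auto simp: amalgam_def intro: finite_subset)
qed

lemma amalgam_structure_of: "structure_of \<Delta> amalgam"
  unfolding structure_of_def
proof (intro allI impI)
  fix i xs assume "xs \<in> rel amalgam i"
  then obtain f ys where "f \<in> Tr" "ys \<in> rel F i" "set ys \<subseteq> part (\<chi> f)" "xs = map (copy f) ys"
    by (auto simp: amalgam_def)
  then show "\<Delta> i = Some (length xs) \<and> set xs \<subseteq> verts amalgam"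
    using F(1) unfolding structure_of_def amalgam_def by auto
qed

lemma rel_amalgamE:
  assumes "xs \<in> rel amalgam i"
  obtains f where "f \<in> Tr" "map fst xs \<in> rel F i" "set (map fst xs) \<subseteq> part (\<chi> f)"
    "xs = map (copy f) (map fst xs)"
proof -
  obtain f ys where f: "f \<in> Tr" "ys \<in> rel F i" "set ys \<subseteq> part (\<chi> f)" "xs = map (copy f) ys"
    using assms by (auto simp: amalgam_def)
  then have "map fst xs = ys" by (simp add: comp_def)
  then show ?thesis using that[of f] f by simp
qed

text \<open>Folding the blow-up onto \<open>F\<close> reduces the other members of the family to
  incomparability with \<open>F\<close>, leaving only homomorphisms from \<open>F\<close>
  itself.\<close>

lemma hom_fst: "is_hom amalgam F fst"
proof -
  have "fst ` verts amalgam \<subseteq> verts F"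
  proof
    fix v assume "v \<in> fst ` verts amalgam"
    then obtain f where "v \<in> part (\<chi> f)" by (auto simp: amalgam_def)
    then show "v \<in> verts F" using part_verts by blast
  qed
  moreover have "map fst xs \<in> rel F i" if "xs \<in> rel amalgam i" for xs i
    using that by (rule rel_amalgamE)
  ultimately show ?thesis by (simp add: is_hom_def)
qed

lemma copy_rel:
  "f \<in> Tr \<Longrightarrow> xs \<in> rel F i \<Longrightarrow> set xs \<subseteq> part (\<chi> f) \<Longrightarrow> map (copy f) xs \<in> rel amalgam i"
  by (auto simp: amalgam_def)

lemma copy_rel_iff:
  assumes "f \<in> Tr" "set ys \<subseteq> C"
  shows "map (copy f) ys \<in> rel amalgam i \<longleftrightarrow> ys \<in> rel F i"
proof
  assume "map (copy f) ys \<in> rel amalgam i"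
  then have "map fst (map (copy f) ys) \<in> rel F i" using hom_fst unfolding is_hom_def by blast
  then show "ys \<in> rel F i" by (simp add: comp_def)
next
  assume "ys \<in> rel F i"
  then show "map (copy f) ys \<in> rel amalgam i"
    using assms C_part by (intro copy_rel) auto
qed

text \<open>A section is constant on each side of the cut, hence uses one transversal for both sides,
  although that transversal carries only one of them.\<close>

lemma no_section:
  assumes s: "is_hom F amalgam s" "\<And>v. v \<in> verts F \<Longrightarrow> fst (s v) = v"
  shows False
proof -
  let ?G = "gaifman F"
  have edge: "\<exists>g. s u = copy g u \<and> s v = copy g v" if uv: "(u, v) \<in> ?G" for u v
  proof -
    obtain i xs where xs: "xs \<in> rel F i" "u \<in> set xs" "v \<in> set xs"
      using uv by (auto simp: gaifman_def)
    then have "map s xs \<in> rel amalgam i" using s(1) by (simp add: is_hom_def)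
    then obtain g where g: "map s xs = map (copy g) (map fst (map s xs))" by (rule rel_amalgamE)
    have "set xs \<subseteq> verts F" using F(1) xs(1) unfolding structure_of_def by blast
    then have "map fst (map s xs) = xs" using s(2) by (auto intro!: map_idI)
    then have "map s xs = map (copy g) xs" using g by simp
    then show ?thesis using xs by auto
  qed
  have follow: "\<exists>f\<in>Tr. M \<inter> part (\<chi> f) \<noteq> {} \<and> (\<forall>c\<in>C. s c = copy f c)"
    if M: "linked ?G M" "nbr ?G M = C" "M \<inter> C = {}" "M \<subseteq> verts F" for M
  proof -
    obtain x where x: "x \<in> M" using M(1) by (auto simp: linked_def)
    then have "s x \<in> verts amalgam" using s(1) M(4) by (auto simp: is_hom_def)
    then obtain f w where f: "f \<in> Tr" "w \<in> part (\<chi> f)" "s x = copy f w" by (auto simp: amalgam_def)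
    have "w = x" using f(3) s(2)[of x] x M(4) by auto
    \<comment> \<open>Away from the cut a copied vertex carries its entire transversal, so adjacent
      vertices carry the same one.\<close>
    have all: "s y = (y, f)" if "y \<in> M" for y
    proof -
      have "(x, y) \<in> (Restr ?G M)\<^sup>*" using M(1) x that by (simp add: linked_def)
      then show ?thesis
      proof (induction rule: rtrancl_induct)
        case base
        show ?case using f(3) \<open>w = x\<close> x M(3) by (auto simp: copy_def)
      next
        case (step y z)
        then obtain g where "s y = copy g y" "s z = copy g z" using edge[of y z] by auto
        moreover have "y \<notin> C" "z \<notin> C" using step(2) M(3) by auto
        ultimately show ?case using step(3) by (simp add: copy_def)
      qed
    qed
    have "s c = copy f c" if c: "c \<in> C" for c
    proof -
      obtain d where d: "d \<in> M" "(d, c) \<in> ?G" using c M(2) by (auto simp: nbr_def)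
      then obtain g where "s d = copy g d" "s c = copy g c" using edge[of d c] by auto
      moreover have "d \<notin> C" using d M(3) by auto
      ultimately show ?thesis using all[OF d(1)] by (simp add: copy_def)
    qed
    then show ?thesis using f x \<open>w = x\<close> by blast
  qed
  obtain f where f: "f \<in> Tr" "D \<inter> part (\<chi> f) \<noteq> {}" "\<forall>c\<in>C. s c = copy f c"
    using follow[OF linkedD lobes(4) _ lobes(2)] CD by blast
  obtain g where g: "g \<in> Tr" "E \<inter> part (\<chi> g) \<noteq> {}" "\<forall>c\<in>C. s c = copy g c"
    using follow[OF linkedE nbrE _ lobes(3)] CE by blast
  have "f c = g c" if "c \<in> C" for c
  proof -
    have "copy f c = copy g c" using f(3) g(3) that by simp
    then show ?thesis using that by (simp add: copy_def fun_eq_iff)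
  qed
  then have "f = g" using f(1) g(1) by (auto simp: Tr_def intro: PiE_ext)
  moreover have "\<chi> f" using f(2) by (auto simp: part_def split: if_splits)
  moreover have "\<not> \<chi> g" using g(2) CE DE by (auto simp: part_def split: if_splits)
  ultimately show False by simp
qed

text \<open>Since \<open>F\<close> is a core, following \<open>h\<close> by the projection is an
  automorphism of \<open>F\<close>; precomposing \<open>h\<close> with its inverse gives a
  section.\<close>

lemma no_hom_amalgam:
  assumes core: "is_core F" and h: "is_hom F amalgam h"
  shows False
proof -
  let ?\<sigma> = "fst \<circ> h"
  have iso: "is_iso F F ?\<sigma>" using core hom_comp[OF h hom_fst] unfolding is_core_def by blast
  then have \<sigma>: "?\<sigma> ` verts F = verts F" "inj_on ?\<sigma> (verts F)"
    and emb: "is_embedding F F ?\<sigma>" by (auto simp: is_iso_def is_embedding_def)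
  let ?\<tau> = "inv_into (verts F) ?\<sigma>"
  have \<tau>: "?\<tau> v \<in> verts F" "?\<sigma> (?\<tau> v) = v" if "v \<in> verts F" for v
    using that \<sigma>(1) inv_into_into[of v ?\<sigma> "verts F"] f_inv_into_f[of v ?\<sigma> "verts F"] by auto
  have "map ?\<tau> xs \<in> rel F i" if xs: "xs \<in> rel F i" for xs i
  proof -
    have sub: "set xs \<subseteq> verts F" using F(1) xs unfolding structure_of_def by blast
    have "map ?\<sigma> (map ?\<tau> xs) = xs"
      unfolding map_map by (rule map_idI) (use sub \<tau>(2) in auto)
    moreover have "set (map ?\<tau> xs) \<subseteq> verts F" using sub \<tau>(1) by auto
    ultimately show ?thesis using emb xs unfolding is_embedding_def by metis
  qed
  then have "is_hom F F ?\<tau>" using \<tau>(1) by (auto simp: is_hom_def)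
  then have "is_hom F amalgam (h \<circ> ?\<tau>)" using h by (rule hom_comp)
  then show False by (rule no_section) (use \<tau>(2) in simp)
qed

end

text \<open>Nothing is known of the lifts except the arity bound, so the argument examines the
  blow-up only as embedded in \<open>U\<close>. The contradiction is a homomorphism from
  \<open>F\<close> into the shadow of \<open>U\<close>.\<close>

lemma minimal_cut_bound:
  fixes \<K> :: "nat rstruct set" and \<F> :: "'v rstruct set"
  assumes fam: "minimal_family \<Delta> \<F>"
    and \<Delta>': "finite_type \<Delta>'" "\<And>i n. i \<notin> dom \<Delta> \<Longrightarrow> \<Delta>' i = Some n \<Longrightarrow> n \<le> r"
    and \<K>: "\<And>A. A \<in> \<K> \<Longrightarrow> structure_of \<Delta>' A" "shadow \<Delta> ` \<K> = Forb_h \<Delta> \<F>" "generic_for \<K> U"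
    and mem: "F \<in> \<F>" and C: "minimal_cut F C"
  shows "card C \<le> r"
proof (rule ccontr)
  assume "\<not> card C \<le> r"
  then have r: "r < card C" by simp
  have sF: "structure_of \<Delta> F" "finite (verts F)" and core: "is_core F"
    using fam mem by (auto simp: minimal_family_def)
  have incomparable: "\<not> is_hom F1 F2 h" if "F1 \<in> \<F>" "F2 \<in> \<F>" "F1 \<noteq> F2" for F1 F2 h
    using fam that unfolding minimal_family_def by blast
  obtain D E where DE: "lobes (gaifman F) D E" "D \<subseteq> verts F" "E \<subseteq> verts F" "nbr (gaifman F) D = C"
    using minimal_cut_lobes[OF sF(1) C] .
  have Cv: "C \<subseteq> verts F" using nbr_subset_verts[OF sF(1), of D] DE(4) by simp
  define I where "I = dom \<Delta>' - dom \<Delta>"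
  have "finite I" using \<Delta>'(1) by (simp add: I_def finite_type_def)
  have "finite C" using Cv sF(2) by (rule finite_subset)
  obtain N \<chi> where col: "\<forall>L. \<exists>f\<in>C \<rightarrow>\<^sub>E {..<N}. \<exists>g\<in>C \<rightarrow>\<^sub>E {..<N}. \<chi> f \<and> \<not> \<chi> g \<and>
    (\<forall>i\<in>I. \<forall>ys. set ys \<subseteq> C \<longrightarrow> length ys \<le> r \<longrightarrow>
      ((i, map (\<lambda>c. (c, f c :: nat)) ys) \<in> L \<longleftrightarrow> (i, map (\<lambda>c. (c, g c)) ys) \<in> L))"
    using colouring_not_determined[OF \<open>finite C\<close> \<open>finite I\<close> r] by blast
  interpret cut_amalgam \<Delta> F D E C N \<chi>
    by unfold_locales (fact sF DE)+
  obtain \<iota> :: "_ \<Rightarrow> nat" where \<iota>: "inj_on \<iota> (verts amalgam)"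
    using finite_imp_inj_to_nat_seg[OF finite_amalgam] by blast
  let ?A = "image_structure \<iota> amalgam"
  have "\<not> is_hom F' ?A h" if F': "F' \<in> \<F>" for F' h
  proof
    assume "is_hom F' ?A h"
    then have h: "is_hom F' amalgam (inv_into (verts amalgam) \<iota> \<circ> h)"
      using hom_image_inv[OF amalgam_structure_of \<iota>] by (rule hom_comp)
    show False
    proof (cases "F' = F")
      case True
      then show ?thesis using no_hom_amalgam[OF core] h by blast
    next
      case False
      then show ?thesis using incomparable[OF F' mem] hom_comp[OF h hom_fst] by blast
    qed
  qed
  then have "?A \<in> Forb_h \<Delta> \<F>"
    using image_structure_of[OF amalgam_structure_of] by (auto simp: Forb_h_def)
  then obtain X where X: "X \<in> \<K>" "shadow \<Delta> X = ?A" using \<K>(2) by (metis imageE)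
  obtain \<epsilon> where \<epsilon>: "is_embedding X U \<epsilon>" using \<K>(3) X(1) by (auto simp: generic_for_def)
  have U: "U \<in> \<K>" "ultrahomogeneous U" using \<K>(3) by (auto simp: generic_for_def)
  have vX: "verts X = \<iota> ` verts amalgam"
  proof -
    have "verts X = verts (shadow \<Delta> X)" by (simp add: shadow_def)
    then show ?thesis unfolding X(2) by (simp add: image_structure_def)
  qed
  have rel_U: "map (\<epsilon> \<circ> \<iota>) xs \<in> rel U i \<longleftrightarrow> xs \<in> rel amalgam i"
    if i: "i \<in> dom \<Delta>" and xs: "set xs \<subseteq> verts amalgam" for xs i
  proof -
    have "set (map \<iota> xs) \<subseteq> verts X" using xs vX by auto
    then have "map \<epsilon> (map \<iota> xs) \<in> rel U i \<longleftrightarrow> map \<iota> xs \<in> rel X i"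
      using \<epsilon> unfolding is_embedding_def by blast
    also have "rel X i = rel (shadow \<Delta> X) i" using i by (simp add: shadow_def)
    also have "map \<iota> xs \<in> rel (shadow \<Delta> X) i \<longleftrightarrow> xs \<in> rel amalgam i"
      unfolding X(2) by (rule image_structure_rel[OF amalgam_structure_of \<iota> xs])
    finally show ?thesis by simp
  qed
  have inj: "inj_on (\<epsilon> \<circ> \<iota>) (verts amalgam)"
    using \<epsilon> \<iota> vX by (intro comp_inj_on) (auto simp: is_embedding_def)
  \<comment> \<open>The relations of \<open>U\<close> pulled back to
    \<open>C \<times> {..<N}\<close>: the vertex over \<open>c\<close> with value \<open>n\<close>
    is \<open>(c, \<lambda>_. n)\<close>, whichever transversal it came from.\<close>
  define L where "L = {(i, zs). map (\<lambda>(c, n). \<epsilon> (\<iota> (c, \<lambda>_. n))) zs \<in> rel U i}"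
  obtain f g where fg: "f \<in> Tr" "g \<in> Tr" "\<chi> f" "\<not> \<chi> g"
    and same: "\<And>i ys. i \<in> I \<Longrightarrow> set ys \<subseteq> C \<Longrightarrow> length ys \<le> r \<Longrightarrow>
      (i, map (\<lambda>c. (c, f c)) ys) \<in> L \<longleftrightarrow> (i, map (\<lambda>c. (c, g c)) ys) \<in> L"
    using col[rule_format, of L] unfolding Tr_def by blast
  define j where "j f v = \<epsilon> (\<iota> (copy f v))" for f v
  have copy_verts: "copy f v \<in> verts amalgam" if "f \<in> Tr" "v \<in> part (\<chi> f)" for f v
    using that by (auto simp: amalgam_def)
  have copy_verts_C: "copy f v \<in> verts amalgam" if "f \<in> Tr" "v \<in> C" for f v
    by (rule copy_verts[OF that(1) subsetD[OF C_part that(2)]])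
  have j_map: "map (j f) xs = map (\<epsilon> \<circ> \<iota>) (map (copy f) xs)" for f xs by (simp add: j_def)
  have j_verts: "j f v \<in> verts U" if "f \<in> Tr" "v \<in> part (\<chi> f)" for f v
    using copy_verts[OF that] \<epsilon> vX by (auto simp: j_def is_embedding_def)
  have j_verts_C: "j f v \<in> verts U" if "f \<in> Tr" "v \<in> C" for f v
    by (rule j_verts[OF that(1) subsetD[OF C_part that(2)]])
  have j_rel: "map (j f) xs \<in> rel U i" if "f \<in> Tr" "xs \<in> rel F i" "set xs \<subseteq> part (\<chi> f)" for f xs i
  proof -
    have "i \<in> dom \<Delta>" using sF(1) that(2) unfolding structure_of_def by blast
    moreover have "set (map (copy f) xs) \<subseteq> verts amalgam" using that copy_verts by auto
    ultimately show ?thesis unfolding j_map using rel_U copy_rel[OF that] by blast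
  qed
  have j_inj: "inj_on (j f) C" if "f \<in> Tr" for f
  proof (rule inj_onI)
    fix c d assume cd: "c \<in> C" "d \<in> C" "j f c = j f d"
    then have "copy f c = copy f d"
      using inj_onD[OF inj, of "copy f c" "copy f d"] copy_verts_C[OF that] by (simp add: j_def)
    then show "c = d" by (simp add: copy_def)
  qed
  have j_old: "map (j f) ys \<in> rel U i \<longleftrightarrow> ys \<in> rel F i"
    if "f \<in> Tr" "set ys \<subseteq> C" "i \<in> dom \<Delta>" for f ys i
  proof -
    have "copy f y \<in> verts amalgam" if "y \<in> set ys" for y
      using copy_verts_C[OF \<open>f \<in> Tr\<close>] that \<open>set ys \<subseteq> C\<close> by blast
    then have "set (map (copy f) ys) \<subseteq> verts amalgam" by auto
    then show ?thesis unfolding j_map using rel_U[OF that(3)] copy_rel_iff[OF that(1,2)] by blast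
  qed
  have j_L: "map (j f) ys \<in> rel U i \<longleftrightarrow> (i, map (\<lambda>c. (c, f c)) ys) \<in> L"
    if "set ys \<subseteq> C" for f ys i
  proof -
    have eq: "map (\<lambda>(c, n). \<epsilon> (\<iota> (c, \<lambda>_. n))) (map (\<lambda>c. (c, f c)) ys) = map (j f) ys"
      using that by (auto simp: j_def copy_def)
    show ?thesis unfolding L_def mem_Collect_eq prod.case eq ..
  qed
  have U_arity: "\<Delta>' i = Some (length xs)" if "xs \<in> rel U i" for xs i
    using \<K>(1)[OF U(1)] that unfolding structure_of_def by blast
  \<comment> \<open>Old relations agree because both transversals carry the structure of
    \<open>F\<close> on \<open>C\<close>; new ones agree by the choice of \<open>f\<close> and
    \<open>g\<close>, as their tuples have length at most \<open>r\<close>.\<close>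
  have eq_type: "map (j f) ys \<in> rel U i \<longleftrightarrow> map (j g) ys \<in> rel U i" if ys: "set ys \<subseteq> C" for ys i
  proof (cases "i \<in> dom \<Delta>")
    case True
    then show ?thesis using j_old[OF fg(1) ys] j_old[OF fg(2) ys] by simp
  next
    case False
    show ?thesis
    proof (cases "\<Delta>' i = Some (length ys)")
      case True
      then have "i \<in> I" "length ys \<le> r" using False \<Delta>'(2) by (auto simp: I_def)
      then show ?thesis using same[OF _ ys] j_L[OF ys] by blast
    next
      case False
      then show ?thesis using U_arity[of "map (j f) ys" i] U_arity[of "map (j g) ys" i] by auto
    qed
  qed
  define h where "h = j g \<circ> inv_into C (j f)"
  have hj: "h (j f c) = j g c" if "c \<in> C" for c
    using that j_inj[OF fg(1)] by (simp add: h_def)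
  have verts_ind: "verts (induced U (j f ` C)) = j f ` C" if "f \<in> Tr" for f
    using j_verts_C[OF that] by (auto simp: induced_def)
  have "is_iso (induced U (j f ` C)) (induced U (j g ` C)) h"
    unfolding is_iso_def is_embedding_def verts_ind[OF fg(1)] verts_ind[OF fg(2)]
  proof (intro conjI allI impI)
    show img: "h ` j f ` C = j g ` C" using hj by force
    then show "h ` j f ` C \<subseteq> j g ` C" by simp
    show "inj_on h (j f ` C)"
    proof (rule inj_onI)
      fix x y assume xy: "x \<in> j f ` C" "y \<in> j f ` C" "h x = h y"
      then obtain c d where cd: "c \<in> C" "d \<in> C" "x = j f c" "y = j f d" by auto
      then have "j g c = j g d" using hj xy(3) by simp
      then have "c = d" using inj_onD[OF j_inj[OF fg(2)]] cd by blast
      then show "x = y" using cd by simp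
    qed
    fix i xs assume "set xs \<subseteq> j f ` C"
    then have "xs \<in> lists (j f ` C)" by auto
    then obtain ys where ys: "set ys \<subseteq> C" "xs = map (j f) ys" by (auto simp: lists_image)
    have eq: "map h xs = map (j g) ys" using ys hj by auto
    show "xs \<in> rel (induced U (j f ` C)) i \<longleftrightarrow> map h xs \<in> rel (induced U (j g ` C)) i"
      unfolding eq unfolding ys(2) using ys(1) eq_type[OF ys(1)] by (auto simp: induced_def)
  qed
  moreover have "finite (j f ` C)" "j f ` C \<subseteq> verts U" "j g ` C \<subseteq> verts U"
    using \<open>finite C\<close> j_verts_C[OF fg(1)] j_verts_C[OF fg(2)] by auto
  ultimately obtain k where k: "is_iso U U k" "\<forall>x\<in>j f ` C. k x = h x"
    using U(2)[unfolded ultrahomogeneous_def, rule_format, of "j f ` C" "j g ` C" h] by blast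
  \<comment> \<open>The side \<open>D\<close> attached along \<open>f\<close> is carried over by the
    automorphism \<open>k\<close>, the rest of \<open>F\<close> is taken along \<open>g\<close>, and
    the two maps coincide on \<open>C\<close>.\<close>
  define \<phi> where "\<phi> v = (if v \<in> D then k (j f v) else j g v)" for v
  have kjf: "\<phi> v = k (j f v)" if "v \<in> D \<union> C" for v
    using that k(2) hj CD by (auto simp: \<phi>_def)
  have parts: "part (\<chi> f) = D \<union> C" "part (\<chi> g) = verts F - D" using fg by (auto simp: part_def)
  have sU: "set xs \<subseteq> verts U" if "xs \<in> rel U i" for xs i
    using \<K>(1)[OF U(1)] that unfolding structure_of_def by blast
  have "map \<phi> xs \<in> rel U i" if xs: "xs \<in> rel F i" for xs i
  proof (cases "set xs \<inter> D = {}")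
    case True
    have "set xs \<subseteq> verts F" using sF(1) xs unfolding structure_of_def by blast
    then have "map (j g) xs \<in> rel U i" using True by (intro j_rel fg xs) (auto simp: parts)
    moreover have "map \<phi> xs = map (j g) xs" using True by (auto simp: \<phi>_def)
    ultimately show ?thesis by (simp only:)
  next
    case False
    then have sub: "set xs \<subseteq> D \<union> C" using tuple_subset[OF xs] lobes(4) by blast
    then have jf: "map (j f) xs \<in> rel U i" by (intro j_rel fg xs) (simp add: parts)
    then have "map k (map (j f) xs) \<in> rel U i"
      using k(1) sU[OF jf] unfolding is_iso_def is_embedding_def by blast
    moreover have "map \<phi> xs = map k (map (j f) xs)" using sub kjf by auto
    ultimately show ?thesis by (simp only:)
  qed
  moreover have "\<phi> v \<in> verts U" if "v \<in> verts F" for v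
  proof (cases "v \<in> D")
    case True
    then have "j f v \<in> verts U" using j_verts fg(1) parts by blast
    then show ?thesis using True k(1) by (auto simp: \<phi>_def is_iso_def)
  next
    case False
    then show ?thesis using j_verts fg(2) parts that by (auto simp: \<phi>_def)
  qed
  moreover have "i \<in> dom \<Delta>" if "xs \<in> rel F i" for xs i
    using sF(1) that unfolding structure_of_def by blast
  ultimately have "is_hom F (shadow \<Delta> U) \<phi>" by (auto simp: is_hom_def shadow_def)
  moreover have "shadow \<Delta> U \<in> Forb_h \<Delta> \<F>" using \<K>(2) U(1) by blast
  ultimately show False using mem by (auto simp: Forb_h_def)
qed

theorem theorem8p12:
  fixes \<Delta> :: signature and \<F> :: "'v rstruct set" and r :: nat
  assumes "finite_type \<Delta>"
    and "minimal_family \<Delta> \<F>"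
    and "\<And>F. F \<in> \<F> \<Longrightarrow> connected_structure F"
    and "r \<ge> 1"
  shows "(\<exists>\<Delta>' (\<K> :: nat rstruct set).
            finite_type \<Delta>' \<and> \<Delta> \<subseteq>\<^sub>m \<Delta>' \<and>
            (\<forall>i n. i \<notin> dom \<Delta> \<and> \<Delta>' i = Some n \<longrightarrow> n \<le> r) \<and>
            (\<forall>A\<in>\<K>. structure_of \<Delta>' A) \<and>
            shadow \<Delta> ` \<K> = Forb_h \<Delta> \<F> \<and>
            (\<exists>U. generic_for \<K> U))
         \<longleftrightarrow> (\<forall>F\<in>\<F>. \<forall>C. minimal_cut F C \<longrightarrow> card C \<le> r)"
    (is "?lifts \<longleftrightarrow> ?cuts")
proof
  assume ?lifts
  then obtain \<Delta>' U and \<K> :: "nat rstruct set" where lifts: "finite_type \<Delta>'"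
    "\<And>i n. i \<notin> dom \<Delta> \<Longrightarrow> \<Delta>' i = Some n \<Longrightarrow> n \<le> r" "\<And>A. A \<in> \<K> \<Longrightarrow> structure_of \<Delta>' A"
    "shadow \<Delta> ` \<K> = Forb_h \<Delta> \<F>" "generic_for \<K> U"
    by (elim exE conjE) blast
  show ?cuts
    by (intro ballI allI impI) (rule minimal_cut_bound[OF assms(2) lifts])
next
  assume cuts: ?cuts
  let ?P = "{(F, D). F \<in> \<F> \<and> is_piece F D}"
  have mem: "structure_of \<Delta> F \<and> finite (verts F) \<and> connected_structure F" if "F \<in> \<F>" for F
    using that assms(2,3) by (auto simp: minimal_family_def)
  have fin: "finite \<F>" using assms(2) by (simp add: minimal_family_def)
  have "?P \<subseteq> (SIGMA F:\<F>. Pow (verts F))" by (auto simp: is_piece_def)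
  moreover have "finite (SIGMA F:\<F>. Pow (verts F))" using fin mem by blast
  ultimately have finP: "finite ?P" by (rule finite_subset)
  have infD: "infinite (- dom \<Delta>)"
    using assms(1) by (simp add: finite_type_def finite_compl)
  \<comment> \<open>Fresh symbols, one per piece, exist since the type is finite.\<close>
  obtain Q where Q: "Q \<subseteq> - dom \<Delta>" "finite Q" "card Q = card ?P"
    using infinite_arbitrarily_large[OF infD, of "card ?P"] by blast
  obtain idx where idx: "bij_betw idx ?P Q"
    using finite_same_card_bij[OF finP Q(2)] Q(3) by auto
  have "\<exists>l. set l = nbr (gaifman F) D \<and> distinct l" if "F \<in> \<F>" for F D
  proof (rule finite_distinct_list)
    show "finite (nbr (gaifman F) D)"
      using mem[OF that] nbr_subset_verts[of \<Delta> F D] by (auto intro: finite_subset)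
  qed
  then have "\<forall>p\<in>?P. \<exists>l. set l = nbr (gaifman (fst p)) (snd p) \<and> distinct l" by auto
  from bchoice[OF this] obtain roots where
    roots: "\<forall>p\<in>?P. set (roots p) = nbr (gaifman (fst p)) (snd p) \<and> distinct (roots p)" by blast
  interpret piece_lift \<Delta> \<F> idx roots
  proof
    show "inj_on idx ?P" using idx by (simp add: bij_betw_def)
    show "idx (F, D) \<notin> dom \<Delta>" if "F \<in> \<F>" "is_piece F D" for F D
    proof -
      have "idx (F, D) \<in> Q" using idx that by (auto simp: bij_betw_def)
      then show ?thesis using Q(1) by auto
    qed
    show "set (roots (F, D)) = nbr (gaifman F) D \<and> distinct (roots (F, D))"
      if "F \<in> \<F>" "is_piece F D" for F D using bspec[OF roots, of "(F, D)"] that by simp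
  qed (use assms(1) fin mem in auto)
  have "\<Delta> \<subseteq>\<^sub>m lift_type" by (auto simp: map_le_def lift_type_def)
  moreover have "n \<le> r" if i: "i \<notin> dom \<Delta>" "lift_type i = Some n" for i n
  proof -
    have "i \<in> idx ` pieces" using i by (simp add: lift_type_def split: if_splits)
    then obtain F D where FD: "(F, D) \<in> pieces" "i = idx (F, D)" by auto
    \<comment> \<open>The arity is the size of the boundary of a piece, which is a minimal cut, so
      the bound on cuts applies.\<close>
    then have "n = card (nbr (gaifman F) D)"
      using i(2) lift_type_idx[OF FD(1)] piecesD(8)[OF FD(1)] distinct_card[OF piecesD(9)[OF FD(1)]]
      by simp
    moreover obtain E where "E \<subseteq> verts F" "lobes (gaifman F) D E"
      using piecesD(2)[OF FD(1)] by (auto simp: is_piece_def)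
    then have "minimal_cut F (nbr (gaifman F) D)"
      using minimal_cut_nbr[OF piecesD(3)[OF FD(1)]] piecesD(6)[OF FD(1)] by blast
    ultimately show ?thesis using cuts piecesD(1)[OF FD(1)] by simp
  qed
  moreover have "structure_of \<Delta> A" if "A \<in> Forb_h \<Delta> \<F>" for A using that by (simp add: Forb_h_def)
  then have "\<forall>A\<in>lift ` Forb_h \<Delta> \<F>. structure_of lift_type A" "shadow \<Delta> ` lift ` Forb_h \<Delta> \<F> = Forb_h \<Delta> \<F>"
    by (simp_all add: structure_of_lift shadow_lift image_image)
  moreover obtain U where "generic_for (lift ` Forb_h \<Delta> \<F>) U" by (rule lift_class_generic)
  ultimately show ?lifts using finite_lift_type by blast
qed

end
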